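(* Consider the mixed integer linear program $$\min_{z}\ c^\top z \quad \text{subject to}\quad a_i^\top z\le b_i,\ i=1,\dots,n,\qquad z\in\mathbb{Z}^{d_Z}\times\mathbb{R}^{d_R},\qquad (\mathrm{MILP})$$ with $d=d_Z+d_R$, $a_i,c\in\mathbb{R}^d$, $b_i\in\mathbb{R}$, whose constraints are distributed among agents $V=\{1,\dots,N_{ag}\}$, $N_{ag}=n$ (agent $i$ knows $c$ and the constraint $a_i^\top z\le b_i$), communicating according to a jointly strongly connected time-varying digraph $\mathcal{G}_c(t)=(V,E(t))$, $t\ge 0$. Let $P=\bigcap_{i=1}^n\{z\in\mathbb{R}^d: a_i^\top z\le b_i\}$ and $S=P\cap(\mathbb{Z}^{d_Z}\times\mathbb{R}^{d_R})$. Assume that $P$ is bounded, that there exists a lexicographically minimal optimal solution $z^\star\in\mathrm{conv}(S)$ with $c^\top z^\star\le c^\top z$ for all $z\in\mathrm{conv}(S)$, and that the optimal cost $J^\star=c^\top z^\star$ is an integer. Let $M>0$ be sufficiently large that the lex-optimal solution of $(\mathrm{MILP})$ does not change if the constraint set $P$ is replaced by $P\cap H_M$, where $H_M=\bigcap_{k=1}^d\left(\{z_k\le M\}\cap\{z_k\ge -M\}\right)$. Then the algorithm DiMILP solves $(\mathrm{MILP})$ in a finite number of communication rounds; that is, for every $i\in\{1,\dots,N_{ag}\}$, the sequences $\{c^\top z^{[i]}(t)\}_{t\ge 0}$ and $\{z^{[i]}(t)\}_{t\ge0}$ generated by DiMILP converge in a finite number of communication rounds to, respectively, the global optimal cost $J^\star$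 and the lex-optimal solution of $(\mathrm{MILP})$.
   Context: Notation. $z=(x,y)$ with $x\in\mathbb{Z}^{d_Z}$ (or $\mathbb{R}^{d_Z}$ in relaxations) and $y\in\mathbb{R}^{d_R}$. $\{a^\top z\le b\}$ denotes the half-space $\{z\in\mathbb{R}^d: a^\top z\le b\}$. $\mathrm{conv}(S)$ is the convex hull of $S$. For $v,w\in\mathbb{R}^d$, $v>_{lex}w$ if there is $k$ with $v_k>w_k$ and $v_m=w_m$ for all $m<k$. The lex-optimal solution of an optimization problem is the lexicographically minimal one among its optimal solutions. Bases and LP solver. For an LP minimizing $c^\top z$ over an intersection $Q$ of half-spaces, a basis $B$ of $Q$ is the intersection of a minimal number of the half-spaces defining $Q$ such that the lex-optimal solution over $B$ equals the one over $Q$; for lex-optimal solutions $B$ is the intersection of exactly $d$ half-spaces. $\mathrm{LPlexsolv}(Q,c)$ returns the lex-optimal solution of $\min\{c^\top z: z\in Q\}$ together with a basis identifying it. The routine $\mathrm{Pivot}(Q,c)$ likewise returns (by pivoting) the lex-optimal solution over $Q$ and a basis. MIG cut oracle. Let $z_{LP}=(x_{LP},y_{LP})$ be a lex-optimal solution with basis $B_{LP}=\{z: A_Bz\le b_B\}$, $A_B\in\mathbb{R}^{d\times d}$, $b_B\in\mathbb{R}^d$. Let $k$ be the smallest index in $\{1,\dots,d_Z\}$ such that $(x_{LP})_k\notin\mathbb{Z}$. Put $\bar a_{k\ell}=[A_B^{-1}]_{k\ell}$, $f_0=[A_B^{-1}b_B-\lfloor A_B^{-1}b_B\rfloor]_k$,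 $\bar f_0=f_0/(1-f_0)$, $N_+=\{\ell:\bar a_{k\ell}\ge0\}$, $N_-=\{\ell:\bar a_{k\ell}<0\}$. $\mathrm{MIGoracle}(z_{LP},B_{LP})$ returns the half-space $$h_{\mathrm{MIG}}=\Big\{z:\ \sum_{\ell\in N_+}\bar a_{k\ell}[b_B-A_Bz]_\ell-\bar f_0\sum_{\ell\in N_-}\bar a_{k\ell}[b_B-A_Bz]_\ell\ \ge\ f_0\Big\}.$$ If $x_{LP}\in\mathbb{Z}^{d_Z}$, no cut is generated ($h_{\mathrm{MIG}}=\mathbb{R}^d$). Communication. Time is a universal slotted time $t\in\mathbb{N}$. $(i,j)\in E(t)$ iff agent $i$ can send information to agent $j$ at time $t$; $N_i(t)=\{j:(j,i)\in E(t)\}$. Joint strong connectivity: for every $t\in\mathbb{N}$, the digraph $\bigcup_{\tau=t}^{\infty}\mathcal{G}_c(\tau)$ is strongly connected (there is a directed path between every ordered pair of agents). Algorithm DiMILP. Each agent $i$ has state $(z^{[i]},B^{[i]})$. Initialization: $h^{[i]}=\{a_i^\top z\le b_i\}\cap H_M$ and $(z^{[i]}(0),B^{[i]}(0))=\mathrm{LPlexsolv}(h^{[i]},c)$. Evolution, at each communication round $t$, for every agent $i$: (1) $h_c=\{z: c^\top z\ge\lceil c^\top z^{[i]}(t)\rceil\}$; (2) $H_{tmp}=\big(\bigcap_{j\in N_i(t)}B^{[j]}(t)\big)\cap B^{[i]}(t)\cap h^{[i]}\cap h_c$; (3) $(z_{LP},B_{LP})=\mathrm{LPlexsolv}(H_{tmp},c)$;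 (4) $h_{\mathrm{MIG}}=\mathrm{MIGoracle}(z_{LP},B_{LP})$; (5) $(z^{[i]}(t+1),B^{[i]}(t+1))=\mathrm{Pivot}(B_{LP}\cap h_{\mathrm{MIG}},c)$. *)

theory Defs
  imports "HOL-Analysis.Analysis"
begin

text \<open>
  Points of \<open>\<real>\<^sup>d\<close> have type \<open>real ^ 'n\<close>, i.e. \<open>(real, 'n) vec\<close>, with \<open>'n\<close> finite and
  linearly ordered, so that \<open>d = CARD('n)\<close> and the linear order on \<open>'n\<close> is the order of the
  coordinates \<open>1, \<dots>, d\<close>.
  The first \<open>dZ\<close> coordinates are the integer variables \<open>x\<close>, the others are the real variables \<open>y\<close>.
\<close>

definition int_coords :: "nat \<Rightarrow> 'n::{finite,linorder} set" where
  "int_coords dZ = {k. card {m. m < k} < dZ}"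

definition mixed_integer :: "nat \<Rightarrow> (real, 'n::{finite,linorder}) vec set" where
  "mixed_integer dZ = {z. \<forall>k\<in>int_coords dZ. z $ k \<in> \<int>}"


subsection \<open>Lexicographic optimality\<close>

definition lex_greater :: "(real, 'n::{finite,linorder}) vec \<Rightarrow> (real, 'n) vec \<Rightarrow> bool" where
  "lex_greater v w \<longleftrightarrow> (\<exists>k. v $ k > w $ k \<and> (\<forall>m<k. v $ m = w $ m))"

definition optimal :: "real ^ 'n \<Rightarrow> (real ^ 'n) set \<Rightarrow> real ^ 'n \<Rightarrow> bool" where
  "optimal c X z \<longleftrightarrow> z \<in> X \<and> (\<forall>w\<in>X. c \<bullet> z \<le> c \<bullet> w)"

definition lex_optimal ::
    "(real, 'n::{finite,linorder}) vec \<Rightarrow> (real, 'n) vec set \<Rightarrow> (real, 'n) vec \<Rightarrow> bool" where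
  "lex_optimal c X z \<longleftrightarrow>
     optimal c X z \<and> (\<forall>w. optimal c X w \<longrightarrow> w \<noteq> z \<longrightarrow> lex_greater w z)"


subsection \<open>Half-spaces, bases and LP solvers\<close>

definition halfspace :: "real ^ 'n \<Rightarrow> real \<Rightarrow> (real ^ 'n) set" where
  "halfspace a b = {z. a \<bullet> z \<le> b}"

definition halfspaces :: "(real ^ 'n) set set" where
  "halfspaces = {halfspace a b | a b. True}"

text \<open>
  An intersection of half-spaces is represented by the finite family \<open>Q\<close> of the half-spaces
  defining it; its set of points is \<open>\<Inter>Q\<close>, and intersecting two such sets amounts to taking the
  union of the two families.
\<close>

definition same_lex_optimum ::
    "(real, 'n::{finite,linorder}) vec \<Rightarrow> (real, 'n) vec set set \<Rightarrow> (real, 'n) vec set set \<Rightarrow> bool" where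
  "same_lex_optimum c Q B \<longleftrightarrow> (\<exists>z. lex_optimal c (\<Inter>Q) z \<and> lex_optimal c (\<Inter>B) z)"

definition basis ::
    "(real, 'n::{finite,linorder}) vec \<Rightarrow> (real, 'n) vec set set \<Rightarrow> (real, 'n) vec set set \<Rightarrow> bool" where
  "basis c Q B \<longleftrightarrow> B \<subseteq> Q \<and> same_lex_optimum c Q B \<and>
     (\<forall>B'. B' \<subseteq> Q \<and> same_lex_optimum c Q B' \<longrightarrow> card B \<le> card B')"

text \<open>
  The specification shared by the routines LPlexsolv and Pivot. Bases need not be unique, so a
  routine may return any of them; nothing is required when no lex-optimal solution exists.
\<close>

type_synonym 'n lp_solver =
  "(real, 'n) vec set set \<Rightarrow> (real, 'n) vec \<Rightarrow> (real, 'n) vec \<times> (real, 'n) vec set set"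

definition lex_lp_solver :: "'n::{finite,linorder} lp_solver \<Rightarrow> bool" where
  "lex_lp_solver solve \<longleftrightarrow>
     (\<forall>Q c. finite Q \<and> Q \<subseteq> halfspaces \<and> (\<exists>z. lex_optimal c (\<Inter>Q) z) \<longrightarrow>
        lex_optimal c (\<Inter>Q) (fst (solve Q c)) \<and> basis c Q (snd (solve Q c)))"

lemma lex_greater_asym: "lex_greater v w \<Longrightarrow> \<not> lex_greater w v"
proof
  assume "lex_greater v w" "lex_greater w v"
  then obtain k l where "v $ k > w $ k" "\<forall>m<k. v $ m = w $ m"
      "w $ l > v $ l" "\<forall>m<l. w $ m = v $ m"
    unfolding lex_greater_def by blast
  then show False
    by (cases k l rule: linorder_cases) auto
qed

lemma lex_optimal_unique:
  assumes "lex_optimal c X z" "lex_optimal c X w"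
  shows "z = w"
  using assms lex_greater_asym unfolding lex_optimal_def by blast

lemma lex_lp_solver_exists: "\<exists>solve :: 'n::{finite,linorder} lp_solver. lex_lp_solver solve"
proof -
  have "\<exists>B. basis c Q B" if z: "lex_optimal c (\<Inter>Q) z" for Q and c z :: "(real, 'n) vec"
  proof -
    have "Q \<subseteq> Q \<and> same_lex_optimum c Q Q"
      using z unfolding same_lex_optimum_def by auto
    from ex_has_least_nat[of "\<lambda>B. B \<subseteq> Q \<and> same_lex_optimum c Q B", OF this, of card]
    show ?thesis unfolding basis_def by blast
  qed
  then have "basis c Q (SOME B. basis c Q B)" if "\<exists>z. lex_optimal c (\<Inter>Q) z" for Q
    and c :: "(real, 'n) vec"
    using that by (metis someI_ex)
  moreover have "lex_optimal c (\<Inter>Q) (SOME z. lex_optimal c (\<Inter>Q) z)"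
    if "\<exists>z. lex_optimal c (\<Inter>Q) z" for Q and c :: "(real, 'n) vec"
    using that by (rule someI_ex)
  ultimately show ?thesis
    unfolding lex_lp_solver_def
    by (intro exI[of _ "\<lambda>Q c. (SOME z. lex_optimal c (\<Inter>Q) z, SOME B. basis c Q B)"]) simp
qed

lemma few_not_lex_optimal:
  fixes B :: "(real, 'n::{finite,linorder}) vec set set"
  assumes "finite B" "B \<subseteq> halfspaces" "lex_optimal c (\<Inter>B) z"
  shows "CARD('n) \<le> card B"
proof (rule ccontr)
  assume less: "\<not> CARD('n) \<le> card B"
  have "\<forall>h\<in>B. \<exists>p. h = halfspace (fst p) (snd p)"
    using assms(2) unfolding halfspaces_def by fastforce
  then obtain p where p: "\<forall>h\<in>B. h = halfspace (fst (p h)) (snd (p h))"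
    using bchoice[of B "\<lambda>h p. h = halfspace (fst p) (snd p)"] by blast
  define a b where "a = fst \<circ> p" and "b = snd \<circ> p"
  have ab: "h = halfspace (a h) (b h)" if "h \<in> B" for h
    using bspec[OF p that] by (simp add: a_def b_def)
  have "dim (a ` B) < DIM((real, 'n) vec)"
    using less dim_le_card'[of "a ` B"] card_image_le[OF assms(1), of a] assms(1) by simp
  then obtain w where w0: "w \<noteq> 0" and orth: "\<And>y. y \<in> span (a ` B) \<Longrightarrow> orthogonal w y"
    using orthogonal_to_subspace_exists[of "a ` B"] by blast
  have w: "a h \<bullet> w = 0" if "h \<in> B" for h
    using orth[OF span_base[OF imageI[OF that]]] by (simp add: orthogonal_def inner_commute)
  have z: "z \<in> \<Inter>B" and zmin: "\<And>v. v \<in> \<Inter>B \<Longrightarrow> c \<bullet> z \<le> c \<bullet> v"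
    using assms(3) unfolding lex_optimal_def optimal_def by auto
  have pm: "z + s *\<^sub>R w \<in> \<Inter>B" for s
  proof (rule InterI)
    fix h assume h: "h \<in> B"
    then have "z \<in> halfspace (a h) (b h)" using z ab by auto
    then have "z + s *\<^sub>R w \<in> halfspace (a h) (b h)"
      using w[OF h] by (simp add: halfspace_def inner_add_right)
    then show "z + s *\<^sub>R w \<in> h" using ab[OF h] by simp
  qed
  have "c \<bullet> w = 0"
    using zmin[OF pm[of 1]] zmin[OF pm[of "-1"]] by (simp add: inner_add_right inner_diff_right)
  then have "optimal c (\<Inter>B) (z + s *\<^sub>R w)" for s
    using pm zmin unfolding optimal_def by (simp add: inner_add_right)
  then have "lex_greater (z + s *\<^sub>R w) z" if "s \<noteq> 0" for s
    using assms(3) w0 that unfolding lex_optimal_def by simp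
  from this[of 1] this[of "- 1"] have "lex_greater (z + w) z" "lex_greater (z - w) z"
    by simp_all
  then obtain k l where "w $ k > 0" "\<forall>m<k. w $ m = 0" "w $ l < 0" "\<forall>m<l. w $ m = 0"
    unfolding lex_greater_def by auto
  then show False by (cases k l rule: linorder_cases) auto
qed

definition lex_better ::
    "(real, 'n::{finite,linorder}) vec \<Rightarrow> (real, 'n) vec \<Rightarrow> (real, 'n) vec set" where
  "lex_better c z = {w. c \<bullet> w < c \<bullet> z \<or> (c \<bullet> w = c \<bullet> z \<and> lex_greater z w)}"

lemma lex_total: "v \<noteq> w \<Longrightarrow> lex_greater v w \<or> lex_greater (w::(real, 'n::{finite,linorder}) vec) v"
proof -
  assume "v \<noteq> w"
  then have ne: "{k. v $ k \<noteq> w $ k} \<noteq> {}" by (auto simp: vec_eq_iff)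
  define k where "k = Min {k. v $ k \<noteq> w $ k}"
  have "v $ k \<noteq> w $ k" using Min_in[OF _ ne] unfolding k_def by auto
  moreover have "\<forall>m<k. v $ m = w $ m"
    unfolding k_def using Min_le[of "{k. v $ k \<noteq> w $ k}"] by (auto simp: not_less[symmetric])
  ultimately show ?thesis unfolding lex_greater_def by (metis linorder_neqE)
qed

lemma lex_convex:
  assumes "lex_greater z v" "lex_greater z w" "0 \<le> s" "0 \<le> t" "s + t = (1::real)"
  shows "lex_greater z (s *\<^sub>R v + t *\<^sub>R w)"
proof -
  obtain k l where k: "z $ k > v $ k" "\<forall>m<k. z $ m = v $ m"
   and l: "z $ l > w $ l" "\<forall>m<l. z $ m = w $ m"
    using assms unfolding lex_greater_def by blast
  have t: "t = 1 - s" using assms by simp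
  have e: "s * a + t * a = a" for a using assms(5) by (simp add: t algebra_simps)
  show ?thesis
  proof (cases "s = 0 \<or> t = 0")
    case True then show ?thesis using assms(1,2,5) by auto
  next
    case False
    then have st: "s > 0" "t > 0" using assms by auto
    have "v $ min k l \<le> z $ min k l \<and> w $ min k l \<le> z $ min k l \<and>
        (v $ min k l < z $ min k l \<or> w $ min k l < z $ min k l)"
      using k l by (cases k l rule: linorder_cases) (auto simp: min_def)
    then have le: "v $ min k l \<le> z $ min k l" "w $ min k l \<le> z $ min k l"
      and lt: "v $ min k l < z $ min k l \<or> w $ min k l < z $ min k l"
      by auto
    have "s * v $ min k l + t * w $ min k l < z $ min k l"
      using lt
    proof
      assume "v $ min k l < z $ min k l"
      then show ?thesis using st le e[of "z $ min k l"]
        mult_strict_left_mono[of "v $ min k l" "z $ min k l" s] mult_left_mono[of "w $ min k l" "z $ min k l" t]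
        by linarith
    next
      assume "w $ min k l < z $ min k l"
      then show ?thesis using st le e[of "z $ min k l"]
        mult_strict_left_mono[of "w $ min k l" "z $ min k l" t] mult_left_mono[of "v $ min k l" "z $ min k l" s]
        by linarith
    qed
    moreover have "\<forall>m<min k l. z $ m = s * v $ m + t * w $ m"
    proof (intro allI impI)
      fix m assume "m < min k l"
      then have "z $ m = v $ m" "z $ m = w $ m" using k(2) l(2) by auto
      then show "z $ m = s * v $ m + t * w $ m" using e[of "z $ m"] by simp
    qed
    ultimately show ?thesis unfolding lex_greater_def by (intro exI[of _ "min k l"]) simp
  qed
qed

lemma convex_lex_better: "convex (lex_better c z)"
proof (rule convexI)
  fix v w and s t :: real
  assume a: "v \<in> lex_better c z" "w \<in> lex_better c z" "0 \<le> s" "0 \<le> t" "s + t = 1"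
  have t: "t = 1 - s" using a by simp
  have e: "s * q + t * q = q" for q using a(5) by (simp add: t algebra_simps)
  have le: "c \<bullet> v \<le> c \<bullet> z" "c \<bullet> w \<le> c \<bullet> z" using a unfolding lex_better_def by auto
  show "s *\<^sub>R v + t *\<^sub>R w \<in> lex_better c z"
  proof (cases "s = 0 \<or> t = 0")
    case True then show ?thesis using a by auto
  next
    case False
    then have st: "s > 0" "t > 0" using a by auto
    show ?thesis
    proof (cases "c \<bullet> v = c \<bullet> z \<and> c \<bullet> w = c \<bullet> z")
      case True
      then show ?thesis using a lex_convex[of z v w s t] e
        unfolding lex_better_def by (auto simp: inner_add_right)
    next
      case False
      then have "s * (c \<bullet> v) + t * (c \<bullet> w) < c \<bullet> z"
        using st le e[of "c \<bullet> z"] mult_strict_left_mono[of "c \<bullet> v" "c \<bullet> z" s]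
          mult_strict_left_mono[of "c \<bullet> w" "c \<bullet> z" t] mult_left_mono[of "c \<bullet> v" "c \<bullet> z" s]
          mult_left_mono[of "c \<bullet> w" "c \<bullet> z" t] by linarith
      then show ?thesis unfolding lex_better_def by (simp add: inner_add_right)
    qed
  qed
qed

lemma lex_optimal_iff:
  "lex_optimal c X z \<longleftrightarrow> z \<in> X \<and> X \<inter> lex_better c z = {}"
proof
  assume l: "lex_optimal c X z"
  have "w \<notin> lex_better c z" if "w \<in> X" for w
  proof
    assume "w \<in> lex_better c z"
    moreover have "c \<bullet> z \<le> c \<bullet> w" using l that unfolding lex_optimal_def optimal_def by auto
    ultimately have e: "c \<bullet> w = c \<bullet> z" "lex_greater z w" unfolding lex_better_def by auto
    then have "optimal c X w" using l that unfolding lex_optimal_def optimal_def by auto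
    moreover have "w \<noteq> z" using e(2) unfolding lex_greater_def by auto
    ultimately have "lex_greater w z" using l unfolding lex_optimal_def by auto
    with e(2) show False using lex_greater_asym by blast
  qed
  then show "z \<in> X \<and> X \<inter> lex_better c z = {}"
    using l unfolding lex_optimal_def optimal_def by auto
next
  assume r: "z \<in> X \<and> X \<inter> lex_better c z = {}"
  then have 1: "\<And>w. w \<in> X \<Longrightarrow> c \<bullet> z \<le> c \<bullet> w" unfolding lex_better_def by force
  have "lex_greater w z" if "optimal c X w" "w \<noteq> z" for w
  proof -
    have "w \<in> X" "c \<bullet> w = c \<bullet> z" using that r 1 unfolding optimal_def by (auto intro: antisym)
    then have "\<not> lex_greater z w" using r unfolding lex_better_def by auto
    then show ?thesis using lex_total that(2) by blast
  qed
  then show "lex_optimal c X z" using r 1 unfolding lex_optimal_def optimal_def by auto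
qed

lemma small_basis:
  fixes Q :: "(real, 'n::{finite,linorder}) vec set set"
  assumes "finite Q" "Q \<subseteq> halfspaces" "lex_optimal c (\<Inter>Q) z"
  shows "\<exists>B\<subseteq>Q. card B \<le> CARD('n) \<and> lex_optimal c (\<Inter>B) z"
proof (cases "card Q \<le> CARD('n)")
  case True then show ?thesis using assms(3) by blast
next
  case False
  let ?W = "lex_better c z" let ?F = "insert ?W Q"
  have zQ: "z \<in> \<Inter>Q" and emp: "\<Inter>Q \<inter> ?W = {}" using assms(3) by (auto simp: lex_optimal_iff)
  have zW: "z \<notin> ?W" unfolding lex_better_def lex_greater_def by auto
  have WQ: "?W \<notin> Q" using zQ zW by auto
  have "\<not> (\<forall>t\<subseteq>?F. card t = DIM((real, 'n) vec) + 1 \<longrightarrow> \<Inter>t \<noteq> {})"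
  proof
    assume *: "\<forall>t\<subseteq>?F. card t = DIM((real, 'n) vec) + 1 \<longrightarrow> \<Inter>t \<noteq> {}"
    have "\<Inter>?F \<noteq> {}"
    proof (rule Helly)
      show "\<And>t. \<lbrakk>t \<subseteq> ?F; card t = DIM((real, 'n) vec) + 1\<rbrakk> \<Longrightarrow> \<Inter>t \<noteq> {}" using * by blast
      show "DIM((real, 'n) vec) + 1 \<le> card ?F" using False WQ assms(1) by simp
      show "\<forall>s\<in>?F. convex s"
        using assms(2) convex_lex_better unfolding halfspaces_def halfspace_def
        by (auto intro: convex_halfspace_le)
    qed
    with emp show False by auto
  qed
  then obtain t where t: "t \<subseteq> ?F" "card t = CARD('n) + 1" "\<Inter>t = {}" by auto
  have "?W \<in> t" using t zQ by blast
  moreover have "finite t" using t(2) card.infinite by fastforce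
  ultimately have "card (t - {?W}) = CARD('n)" using t(2) by simp
  moreover have "t - {?W} \<subseteq> Q" using t(1) by auto
  moreover have "lex_optimal c (\<Inter>(t - {?W})) z"
    using t(3) zQ \<open>t - {?W} \<subseteq> Q\<close> \<open>?W \<in> t\<close> unfolding lex_optimal_iff by blast
  ultimately show ?thesis by (metis order_refl)
qed

lemma card_basis:
  fixes Q :: "(real, 'n::{finite,linorder}) vec set set"
  assumes "finite Q" "Q \<subseteq> halfspaces" "basis c Q B"
  shows "card B = CARD('n)"
proof (rule antisym)
  obtain z where z: "B \<subseteq> Q" "lex_optimal c (\<Inter>Q) z" "lex_optimal c (\<Inter>B) z"
    using assms(3) unfolding basis_def same_lex_optimum_def by auto
  show "CARD('n) \<le> card B"
    using few_not_lex_optimal[OF _ _ z(3)] z(1) assms finite_subset by blast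
  show "card B \<le> CARD('n)"
    using small_basis[OF assms(1,2) z(2)] assms(3) z(2)
    unfolding basis_def same_lex_optimum_def by (meson order_trans)
qed


subsection \<open>The mixed integer Gomory cut oracle\<close>

text \<open>
  A basis of \<open>d\<close> half-spaces is written as \<open>{z. A *v z \<le> b}\<close>, one row of \<open>A\<close> and \<open>b\<close> for each
  half-space (by \<open>card_basis\<close> distinct rows then give distinct half-spaces). This description is
  unique up to the order of the rows and positive scaling of each row, neither of which affects the
  cut: scaling row \<open>l\<close> by \<open>s > 0\<close> divides column \<open>l\<close> of \<open>matrix_inv A\<close> by \<open>s\<close>.
\<close>

definition describes ::
    "real ^ 'n ^ 'n \<Rightarrow> real ^ 'n \<Rightarrow> (real ^ 'n) set set \<Rightarrow> bool" where
  "describes A b B \<longleftrightarrow> B = range (\<lambda>l. halfspace (A $ l) (b $ l))"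

definition MIG_cut ::
    "real ^ 'n ^ 'n \<Rightarrow> real ^ 'n \<Rightarrow> 'n \<Rightarrow> (real ^ 'n) set" where
  "MIG_cut A b k =
     (let abar = (\<lambda>l. matrix_inv A $ k $ l);
          f0 = frac ((matrix_inv A *v b) $ k);
          fbar0 = f0 / (1 - f0)
      in {z. (\<Sum>l | abar l \<ge> 0. abar l * (b - A *v z) $ l)
             - fbar0 * (\<Sum>l | abar l < 0. abar l * (b - A *v z) $ l) \<ge> f0})"

definition MIG_oracle ::
    "nat \<Rightarrow> (real, 'n::{finite,linorder}) vec \<Rightarrow> (real, 'n) vec set set \<Rightarrow> (real, 'n) vec set" where
  "MIG_oracle dZ z B =
     (if z \<in> mixed_integer dZ then UNIV
      else let k = Min {k \<in> int_coords dZ. z $ k \<notin> \<int>};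
               (A, b) = (SOME (A, b). describes A b B)
           in MIG_cut A b k)"


subsection \<open>Communication and the algorithm DiMILP\<close>

text \<open>\<open>(i, j) \<in> E t\<close> iff agent \<open>i\<close> can send information to agent \<open>j\<close> at time \<open>t\<close>.\<close>

definition in_neighbours :: "(nat \<Rightarrow> (nat \<times> nat) set) \<Rightarrow> nat \<Rightarrow> nat \<Rightarrow> nat set" where
  "in_neighbours E t i = {j. (j, i) \<in> E t}"

definition jointly_strongly_connected :: "nat set \<Rightarrow> (nat \<Rightarrow> (nat \<times> nat) set) \<Rightarrow> bool" where
  "jointly_strongly_connected V E \<longleftrightarrow>
     (\<forall>t. \<forall>i\<in>V. \<forall>j\<in>V. (i, j) \<in> (\<Union>\<tau>\<in>{t..}. E \<tau>)\<^sup>*)"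

definition box_family :: "real \<Rightarrow> (real ^ 'n) set set" where
  "box_family M = (\<Union>k. {{z. z $ k \<le> M}, {z. z $ k \<ge> - M}})"

definition local_family :: "real ^ 'n \<Rightarrow> real \<Rightarrow> real \<Rightarrow> (real ^ 'n) set set" where
  "local_family a b M = insert (halfspace a b) (box_family M)"

definition cost_cut :: "real ^ 'n \<Rightarrow> real ^ 'n \<Rightarrow> (real ^ 'n) set" where
  "cost_cut c z = {w. c \<bullet> w \<ge> of_int \<lceil>c \<bullet> z\<rceil>}"

text \<open>
  \<open>DiMILP \<dots> t i\<close> is the state of agent \<open>i\<close> at time \<open>t\<close>: its point and its basis. The argument
  \<open>h\<close> gives the family of half-spaces \<open>h\<^sup>[\<^sup>i\<^sup>]\<close> known to each agent.
\<close>

primrec DiMILP ::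
    "'n::{finite,linorder} lp_solver \<Rightarrow> 'n lp_solver \<Rightarrow> nat \<Rightarrow> (real, 'n) vec \<Rightarrow>
     (nat \<Rightarrow> (real, 'n) vec set set) \<Rightarrow> (nat \<Rightarrow> (nat \<times> nat) set) \<Rightarrow>
     nat \<Rightarrow> nat \<Rightarrow> (real, 'n) vec \<times> (real, 'n) vec set set" where
  "DiMILP LPlexsolv Pivot dZ c h E 0 = (\<lambda>i. LPlexsolv (h i) c)"
| "DiMILP LPlexsolv Pivot dZ c h E (Suc t) =
     (\<lambda>i. let z = (\<lambda>j. fst (DiMILP LPlexsolv Pivot dZ c h E t j));
              B = (\<lambda>j. snd (DiMILP LPlexsolv Pivot dZ c h E t j));
              hc = cost_cut c (z i);
              Htmp = (\<Union>j\<in>in_neighbours E t i. B j) \<union> B i \<union> h i \<union> {hc};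
              (zLP, BLP) = LPlexsolv Htmp c;
              hMIG = MIG_oracle dZ zLP BLP
          in Pivot (BLP \<union> {hMIG}) c)"

end

theory Submission
  imports Defs
begin

text \<open>
  Compare points first by cost and then lexicographically. This is a total order compatible with the
  vector space structure (\<open>lex_nonneg c (w - v)\<close> says that \<open>w\<close> is at least \<open>v\<close>), and the
  lex-optimal solution of a linear program is the least point of its feasible set. A lex-optimal
  point of \<open>convex hull S\<close> lies in \<open>S\<close> (\<open>lex_optimal_convex_hull\<close>), so \<open>zstar\<close> is the solution
  sought. All half-spaces that are ever generated contain it: the cost cuts because its cost is an
  integer, the Gomory cuts by \<open>MIG_cut_valid\<close>. In particular no linear program is infeasible, and
  all points computed are at most \<open>zstar\<close>.

  Each agent's sequence is nondecreasing: its linear program contains its own basis and those of its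
  neighbours, so \<open>w t\<close>, the solution of the linear program at time \<open>t\<close>, satisfies
  \<open>z t \<le> w t \<le> z (Suc t)\<close>. The cost cuts force \<open>c \<bullet> w (Suc t)\<close> to be at least the ceiling of
  \<open>c \<bullet> w t\<close>, and a bounded nondecreasing sequence with this property is eventually constant and
  integral (\<open>eventually_constant_integer\<close>). Once the cost and the coordinates before \<open>k\<close> are
  constant and integral, coordinate \<open>k\<close> is nondecreasing and bounded by \<open>M\<close>, and the Gomory cut
  rounds it up whenever it is fractional (\<open>MIG_cut_rounds_up\<close>), so the same argument applies. By
  induction all integer coordinates become stationary and integral.

  From then on no Gomory cut is generated and the cost cuts do not change, so all bases are taken
  from a finite pool of half-spaces. Each agent's sequence is monotone with finite range, hence
  eventually constant (\<open>eventually_stationary\<close>). The limits do not decrease along communication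
  edges, so strong connectivity makes them equal (\<open>consensus\<close>). The common limit satisfies every
  agent's constraint and is mixed integer, so it lies in \<open>S\<close>; being at most \<open>zstar\<close>, it is \<open>zstar\<close>.
\<close>


section \<open>The cost-lexicographic order\<close>

text \<open>The cone of nonnegative vectors for the order by cost, with ties broken lexicographically.\<close>

definition lex_nonneg :: "(real, 'n::{finite,linorder}) vec \<Rightarrow> (real, 'n) vec \<Rightarrow> bool" where
  "lex_nonneg c r \<longleftrightarrow> r = 0 \<or> c \<bullet> r > 0 \<or> (c \<bullet> r = 0 \<and> lex_greater r 0)"

lemma lex_better_iff: "v \<in> lex_better c w \<longleftrightarrow> v \<noteq> w \<and> lex_nonneg c (w - v)"
  unfolding lex_better_def lex_nonneg_def lex_greater_def
  by (auto simp: inner_diff_right)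

lemma lex_nonneg_zero [simp]: "lex_nonneg c 0"
  by (simp add: lex_nonneg_def)

lemma lex_nonneg_total: "lex_nonneg c r \<or> lex_nonneg c (- r)"
proof (cases "r = 0")
  case False
  then have "lex_greater r 0 \<or> lex_greater 0 r" by (rule lex_total)
  then have "lex_greater r 0 \<or> lex_greater (- r) 0" by (simp add: lex_greater_def)
  then show ?thesis by (auto simp: lex_nonneg_def)
qed simp

lemma lex_nonneg_antisym: "lex_nonneg c r \<Longrightarrow> lex_nonneg c (- r) \<Longrightarrow> r = 0"
  using lex_greater_asym[of r 0] by (auto simp: lex_nonneg_def lex_greater_def)

lemma lex_nonneg_inner: "lex_nonneg c r \<Longrightarrow> 0 \<le> c \<bullet> r"
  by (auto simp: lex_nonneg_def)

lemma lex_nonneg_component: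
  assumes "lex_nonneg c r" "c \<bullet> r = 0" "\<And>m. m < k \<Longrightarrow> r $ m = 0"
  shows "0 \<le> r $ k"
proof -
  have "r = 0 \<or> (\<exists>j. r $ j > 0 \<and> (\<forall>m<j. r $ m = 0))"
    using assms(1,2) by (auto simp: lex_nonneg_def lex_greater_def)
  then show ?thesis
  proof (elim disjE exE conjE)
    fix j assume "r $ j > 0" "\<forall>m<j. r $ m = 0"
    then show ?thesis using assms(3)[of j] by (cases j k rule: linorder_cases) auto
  qed simp
qed

lemma lex_nonneg_scale: "lex_nonneg c r \<Longrightarrow> 0 \<le> s \<Longrightarrow> lex_nonneg c (s *\<^sub>R r)"
  by (cases "s = 0") (auto simp: lex_nonneg_def lex_greater_def zero_less_mult_iff)

lemma lex_nonneg_add: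
  assumes "lex_nonneg c p" "lex_nonneg c q"
  shows "lex_nonneg c (p + q)"
proof (cases "c \<bullet> p = 0 \<and> c \<bullet> q = 0 \<and> p \<noteq> 0 \<and> q \<noteq> 0")
  case True
  then have "lex_greater p 0" "lex_greater q 0" using assms by (auto simp: lex_nonneg_def)
  then obtain k l where k: "p $ k > 0" "\<forall>m<k. p $ m = 0" and l: "q $ l > 0" "\<forall>m<l. q $ m = 0"
    unfolding lex_greater_def by auto
  have "(p + q) $ min k l > 0 \<and> (\<forall>m<min k l. (p + q) $ m = 0)"
    using k l by (cases k l rule: linorder_cases) (auto simp: min_def)
  then show ?thesis using True
    by (auto simp: lex_nonneg_def lex_greater_def inner_add_right simp del: vector_add_component)
next
  case False
  then show ?thesis
    using assms lex_nonneg_inner[OF assms(1)] lex_nonneg_inner[OF assms(2)]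
    by (auto simp: lex_nonneg_def inner_add_right)
qed

lemma lex_nonneg_sum: "(\<And>l. l \<in> L \<Longrightarrow> lex_nonneg c (p l)) \<Longrightarrow> lex_nonneg c (sum p L)"
  by (induction L rule: infinite_finite_induct) (auto intro: lex_nonneg_add)

lemma lex_nonneg_trans:
  "lex_nonneg c (v - u) \<Longrightarrow> lex_nonneg c (w - v) \<Longrightarrow> lex_nonneg c (w - u)"
  using lex_nonneg_add[of c "v - u" "w - v"] by simp

text \<open>
  Two nonnegative vectors cannot cancel on an initial segment (cost, then the coordinates before
  \<open>k\<close>): the first nonzero entries of both would be positive.
\<close>

lemma lex_nonneg_summand_prefix:
  assumes p: "lex_nonneg c p" and q: "lex_nonneg c q"
    and c0: "c \<bullet> (p + q) = 0" and k0: "\<And>m. m < k \<Longrightarrow> (p + q) $ m = 0"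
  shows "c \<bullet> p = 0 \<and> (\<forall>m<k. p $ m = 0)"
proof
  have c: "c \<bullet> p = 0" "c \<bullet> q = 0"
    using lex_nonneg_inner[OF p] lex_nonneg_inner[OF q] c0 by (auto simp: inner_add_right)
  then show "c \<bullet> p = 0" by simp
  have "m < k \<longrightarrow> p $ m = 0 \<and> q $ m = 0" for m
  proof (induction "card {j. j < m}" arbitrary: m rule: less_induct)
    case less
    show ?case
    proof
      assume m: "m < k"
      have "p $ j = 0 \<and> q $ j = 0" if "j < m" for j
      proof -
        have "{i. i < j} \<subset> {i. i < m}" using that by auto
        then have "card {i. i < j} < card {i. i < m}" by (intro psubset_card_mono) auto
        then show ?thesis using less that m by auto
      qed
      then have "0 \<le> p $ m" "0 \<le> q $ m"
        using lex_nonneg_component[OF p c(1), of m] lex_nonneg_component[OF q c(2), of m] by auto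
      then show "p $ m = 0 \<and> q $ m = 0" using k0[OF m] by auto
    qed
  qed
  then show "\<forall>m<k. p $ m = 0" by blast
qed

lemma lex_optimal_iff_le: "lex_optimal c X z \<longleftrightarrow> z \<in> X \<and> (\<forall>w\<in>X. lex_nonneg c (w - z))"
proof -
  have "w \<notin> lex_better c z \<longleftrightarrow> lex_nonneg c (w - z)" for w
    using lex_nonneg_total[of c "w - z"] lex_nonneg_antisym[of c "w - z"]
    by (auto simp: lex_better_iff)
  then show ?thesis unfolding lex_optimal_iff by blast
qed

lemma lex_optimal_mono:
  "lex_optimal c X z \<Longrightarrow> lex_optimal c Y w \<Longrightarrow> Y \<subseteq> X \<Longrightarrow> lex_nonneg c (w - z)"
  by (auto simp: lex_optimal_iff_le)

lemma convex_lex_ge: "convex {w. lex_nonneg c (w - z)}"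
proof (rule convexI, rule CollectI)
  fix v w and s t :: real
  assume "v \<in> {w. lex_nonneg c (w - z)}" "w \<in> {w. lex_nonneg c (w - z)}" "0 \<le> s" "0 \<le> t"
    and st: "s + t = 1"
  then have "lex_nonneg c (s *\<^sub>R (v - z) + t *\<^sub>R (w - z))"
    by (intro lex_nonneg_add lex_nonneg_scale) auto
  moreover have "s *\<^sub>R v + t *\<^sub>R w - z = s *\<^sub>R (v - z) + t *\<^sub>R (w - z)"
    using scaleR_left_distrib[of s t z] st by (simp add: algebra_simps)
  ultimately show "lex_nonneg c (s *\<^sub>R v + t *\<^sub>R w - z)" by simp
qed

text \<open>The lex-optimal point of a convex hull is extreme, hence one of the generating points.\<close>

lemma lex_optimal_convex_hull:
  assumes "lex_optimal c (convex hull X) z"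
  shows "lex_optimal c X z"
proof -
  have zc: "z \<in> convex hull X" and le: "\<And>w. w \<in> X \<Longrightarrow> lex_nonneg c (w - z)"
    using assms hull_subset[of X convex] by (auto simp: lex_optimal_iff_le)
  have "z \<in> X"
  proof (rule ccontr)
    assume z: "z \<notin> X"
    have "convex (uminus ` lex_better c (- z))"
      by (rule convex_negations[OF convex_lex_better])
    moreover have "X \<subseteq> uminus ` lex_better c (- z)"
    proof
      fix w assume "w \<in> X"
      then have "- w \<in> lex_better c (- z)" using le z by (auto simp: lex_better_iff)
      then show "w \<in> uminus ` lex_better c (- z)" by force
    qed
    ultimately have "convex hull X \<subseteq> uminus ` lex_better c (- z)" by (rule hull_minimal[rotated])
    then show False using zc by (auto simp: lex_better_iff)
  qed
  then show ?thesis using le by (simp add: lex_optimal_iff_le)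
qed

lemma finite_lex_optimal:
  assumes "finite X" "X \<noteq> {}"
  shows "\<exists>z. lex_optimal c X z"
  using assms
proof (induction X rule: finite_ne_induct)
  case (insert x X)
  then obtain z where z: "lex_optimal c X z" by blast
  show ?case
  proof (cases "lex_nonneg c (x - z)")
    case True
    then show ?thesis using z by (auto simp: lex_optimal_iff_le)
  next
    case False
    then have "lex_nonneg c (z - x)" using lex_nonneg_total[of c "x - z"] by simp
    then have "lex_optimal c (insert x X) x"
      using z lex_nonneg_trans[of c z x] by (auto simp: lex_optimal_iff_le)
    then show ?thesis ..
  qed
qed (auto simp: lex_optimal_iff_le)

lemma polytope_lex_optimal:
  assumes "finite Q" "Q \<subseteq> halfspaces" "bounded (\<Inter>Q)" "\<Inter>Q \<noteq> {}"
  shows "\<exists>z. lex_optimal c (\<Inter>Q) z"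
proof -
  have "polyhedron (\<Inter>Q)"
    using assms(1,2) unfolding halfspaces_def halfspace_def
    by (intro polyhedron_Inter) (auto simp: polyhedron_halfspace_le)
  then have "polytope (\<Inter>Q)" using assms(3) by (simp add: polytope_eq_bounded_polyhedron)
  then obtain X where X: "finite X" "\<Inter>Q = convex hull X" unfolding polytope_def by blast
  then obtain z where z: "lex_optimal c X z" using assms(4) finite_lex_optimal[of X c] by auto
  then have "convex hull X \<subseteq> {w. lex_nonneg c (w - z)}"
    by (intro hull_minimal convex_lex_ge) (auto simp: lex_optimal_iff_le)
  then have "lex_optimal c (convex hull X) z"
    using z hull_inc[of z X convex] by (auto simp: lex_optimal_iff_le)
  then show ?thesis using X(2) by auto
qed


section \<open>The cone of a basis\<close>

lemma matrix_inv_inverse: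
  fixes A :: "real ^ 'n ^ 'n"
  assumes "invertible A"
  shows "A ** matrix_inv A = mat 1" "matrix_inv A ** A = mat 1"
  using someI_ex[OF assms[unfolded invertible_def]] by (auto simp: matrix_inv_def)

lemma matrix_vector_mult_uminus: "A *v (- x) = - (A *v x)" for A :: "real ^ 'n ^ 'm"
  using matrix_vector_mult_diff_distrib[of A 0 x] by simp

lemma matrix_vector_mult_column_inv:
  fixes A :: "real ^ 'n ^ 'n"
  assumes "invertible A"
  shows "A *v column l (matrix_inv A) = axis l 1"
proof -
  have "A *v (matrix_inv A *v axis l 1) = axis l 1"
    by (simp add: matrix_vector_mul_assoc matrix_inv_inverse(1)[OF assms])
  then show ?thesis by (simp only: matrix_vector_mult_basis)
qed

lemma exists_describes:
  fixes B :: "(real ^ 'n) set set"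
  assumes "B \<subseteq> halfspaces" "card B = CARD('n)"
  shows "\<exists>A b. describes A b B"
proof -
  have fB: "finite B" using assms(2) card.infinite by fastforce
  then obtain f where f: "bij_betw f (UNIV :: 'n set) B"
    using assms(2) finite_same_card_bij[of "UNIV :: 'n set" B] by auto
  have "\<forall>l. \<exists>p. f l = halfspace (fst p) (snd p)"
    using assms(1) bij_betw_apply[OF f] unfolding halfspaces_def by fastforce
  then obtain p where p: "\<And>l. f l = halfspace (fst (p l)) (snd (p l))" by metis
  have "describes (\<chi> l. fst (p l)) (\<chi> l. snd (p l)) B"
    using f p unfolding describes_def bij_betw_def by simp
  then show ?thesis by blast
qed

lemma describes_Inter: "describes A b B \<Longrightarrow> v \<in> \<Inter>B \<longleftrightarrow> (\<forall>l. (A *v v) $ l \<le> b $ l)"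
  by (simp add: describes_def halfspace_def matrix_vector_mul_component)

text \<open>
  The feasible set of a basis is a simplicial cone with the lex-optimal point as apex, spanned by the
  negated columns of \<open>matrix_inv A\<close>; these are nonnegative since moving along them stays feasible.
\<close>

lemma basis_cone:
  fixes A :: "((real, 'n::{finite,linorder}) vec, 'n) vec"
  assumes d: "describes A b B" and opt: "lex_optimal c (\<Inter>B) z"
  shows "invertible A" "A *v z = b" "lex_nonneg c (- column l (matrix_inv A))"
    "v - z = (\<Sum>l\<in>UNIV. (b - A *v v) $ l *\<^sub>R (- column l (matrix_inv A)))"
proof -
  have zB: "\<And>l. (A *v z) $ l \<le> b $ l" using opt describes_Inter[OF d] by (auto simp: lex_optimal_iff_le)
  have dir: "lex_nonneg c w" if "\<And>l. (A *v z) $ l + (A *v w) $ l \<le> b $ l" for w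
  proof -
    have "z + w \<in> \<Inter>B"
      unfolding describes_Inter[OF d] using that by (simp add: matrix_vector_right_distrib)

    then have "lex_nonneg c (z + w - z)" using opt unfolding lex_optimal_iff_le by blast
    then show ?thesis by simp
  qed
  \<comment> \<open>A kernel direction could be followed both ways, as could column \<open>l\<close> if constraint \<open>l\<close> were slack.\<close>
  have "w = 0" if "A *v w = 0" for w
    using dir[of w] dir[of "- w"] zB that lex_nonneg_antisym[of c w]
    by (simp add: matrix_vector_mult_uminus)
  then show inv: "invertible A"
    using matrix_left_invertible_ker[of A] invertible_left_inverse[of A] by blast
  let ?q = "\<lambda>l. column l (matrix_inv A)"
  have Aq: "A *v ?q l = axis l 1" for l
    by (rule matrix_vector_mult_column_inv[OF inv])
  show "lex_nonneg c (- ?q l)" for l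
    using zB by (intro dir) (simp add: matrix_vector_mult_uminus Aq axis_def add_increasing2 algebra_simps)
  show tight: "A *v z = b"
  proof (rule vec_eq_iff[THEN iffD2], rule allI)
    fix l
    define s where "s = b $ l - (A *v z) $ l"
    have s: "0 \<le> s" using zB[of l] by (simp add: s_def)
    have "lex_nonneg c (s *\<^sub>R ?q l)"
      using zB by (intro dir) (auto simp: matrix_vector_mult_scaleR Aq axis_def s_def)
    moreover have "(A *v z) $ j - s \<le> b $ j" for j using zB[of j] s by simp
    then have "lex_nonneg c (- (s *\<^sub>R ?q l))"
      using zB by (intro dir)
        (auto simp: matrix_vector_mult_uminus matrix_vector_mult_scaleR Aq axis_def)
    ultimately have "s *\<^sub>R ?q l = 0" by (rule lex_nonneg_antisym)
    moreover have "?q l \<noteq> 0" using Aq[of l] by auto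
    ultimately show "(A *v z) $ l = b $ l" by (simp add: s_def)
  qed
  have "(\<Sum>l\<in>UNIV. (b - A *v v) $ l *\<^sub>R ?q l) = matrix_inv A *v (b - A *v v)"
    by (simp add: matrix_mult_sum scalar_mult_eq_scaleR)
  also have "\<dots> = matrix_inv A *v (A *v (z - v))"
    by (simp add: tight matrix_vector_mult_diff_distrib)
  also have "\<dots> = z - v"
    by (simp add: matrix_vector_mul_assoc matrix_inv_inverse(2)[OF inv])
  finally have "z - v = (\<Sum>l\<in>UNIV. (b - A *v v) $ l *\<^sub>R ?q l)" by simp
  then show "v - z = (\<Sum>l\<in>UNIV. (b - A *v v) $ l *\<^sub>R (- ?q l))"
    unfolding scaleR_minus_right sum_negf by (simp add: algebra_simps)
qed

text \<open>
  With \<open>q\<^sub>l\<close> the columns of \<open>matrix_inv A\<close>, the point \<open>v\<close> of the cone is \<open>z + \<Sum>l. s\<^sub>l *\<^sub>R (- q\<^sub>l)\<close>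
  with slacks \<open>s \<ge> 0\<close>. A half-space \<open>\<Sum>l. g\<^sub>l s\<^sub>l \<ge> e\<close> with \<open>g \<ge> 0 < e\<close> cuts off the apex, and
  the best of the points where it meets the extreme rays is lex-optimal.
\<close>

lemma cut_cone_lex_optimal:
  fixes A :: "((real, 'n::{finite,linorder}) vec, 'n) vec"
  assumes d: "describes A b B" and opt: "lex_optimal c (\<Inter>B) z"
    and g: "\<And>l. 0 \<le> g l" and e: "0 < e"
    and H: "H = {v. e \<le> (\<Sum>l\<in>UNIV. g l * (b - A *v v) $ l)}"
    and ne: "p \<in> \<Inter>B \<inter> H"
  shows "\<exists>w. lex_optimal c (\<Inter>B \<inter> H) w"
proof -
  note cone = basis_cone[OF d opt]
  let ?q = "\<lambda>l. column l (matrix_inv A)"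
  have Aq: "A *v ?q l = axis l 1" for l
    by (rule matrix_vector_mult_column_inv[OF cone(1)])
  define v where "v l = z - (e / g l) *\<^sub>R ?q l" for l
  let ?L = "{l. 0 < g l}"
  have "?L \<noteq> {}"
  proof
    assume "?L = {}"
    then have "g l = 0" for l using g[of l] by (metis (mono_tags) empty_iff mem_Collect_eq order_le_less)
    then show False using ne e by (simp add: H)
  qed
  then obtain u where u: "lex_optimal c (v ` ?L) u"
    using finite_lex_optimal[of "v ` ?L" c] by auto
  then obtain l0 where l0: "0 < g l0" "u = v l0" by (auto simp: lex_optimal_iff_le)
  have slack: "(b - A *v v l) $ i = (if i = l then e / g l else 0)" for i l
    by (simp add: v_def matrix_vector_mult_diff_distrib matrix_vector_mult_scaleR cone(2) Aq axis_def)
  have mem: "v l \<in> \<Inter>B \<inter> H" if "0 < g l" for l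
  proof
    have "(A *v v l) $ i \<le> b $ i" for i
    proof -
      have "0 \<le> (b - A *v v l) $ i" unfolding slack using that e by simp
      then show ?thesis by simp
    qed
    then show "v l \<in> \<Inter>B" by (simp only: describes_Inter[OF d]) simp
    have "(\<Sum>i\<in>UNIV. g i * (b - A *v v l) $ i) = (\<Sum>i\<in>UNIV. if i = l then e else 0)"
      using that by (intro sum.cong refl) (simp only: slack, simp)
    then show "v l \<in> H" by (simp add: H)
  qed
  define \<delta> where "\<delta> = u - z"
  have \<delta>: "lex_nonneg c \<delta>"
    using mem[OF l0(1)] opt l0(2) by (auto simp: lex_optimal_iff_le \<delta>_def)
  have "lex_nonneg c (w - u)" if w: "w \<in> \<Inter>B \<inter> H" for w
  proof -
    define s where "s l = (b - A *v w) $ l" for l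
    define \<theta> where "\<theta> = (\<Sum>l\<in>UNIV. s l * g l / e)"
    have s: "0 \<le> s l" for l using w describes_Inter[OF d, of w] by (simp add: s_def)
    have "1 \<le> \<theta>" using w e by (simp add: H \<theta>_def s_def sum_divide_distrib[symmetric] mult.commute)
    have summand: "lex_nonneg c (s l *\<^sub>R (- ?q l) - (s l * g l / e) *\<^sub>R \<delta>)" for l
    proof (cases "g l = 0")
      case True
      then show ?thesis using lex_nonneg_scale[OF cone(3) s, of l l] by simp
    next
      case False
      then have gl: "0 < g l" using g[of l] by simp
      then have "lex_nonneg c (v l - u)" using u by (auto simp: lex_optimal_iff_le)
      then have "lex_nonneg c ((s l * g l / e) *\<^sub>R (v l - u))"
        using s[of l] gl e by (intro lex_nonneg_scale) auto
      moreover have "(s l * g l / e) *\<^sub>R (v l - u) = s l *\<^sub>R (- ?q l) - (s l * g l / e) *\<^sub>R \<delta>"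
        using gl e by (simp add: v_def \<delta>_def algebra_simps)
      ultimately show ?thesis by simp
    qed
    have "lex_nonneg c (\<Sum>l\<in>UNIV. s l *\<^sub>R (- ?q l) - (s l * g l / e) *\<^sub>R \<delta>)"
      using summand by (intro lex_nonneg_sum)
    moreover have "(\<Sum>l\<in>UNIV. s l *\<^sub>R (- ?q l) - (s l * g l / e) *\<^sub>R \<delta>) = w - z - \<theta> *\<^sub>R \<delta>"
      unfolding sum_subtractf \<theta>_def scaleR_left.sum cone(4) s_def ..
    moreover have "lex_nonneg c ((\<theta> - 1) *\<^sub>R \<delta>)"
      using \<open>1 \<le> \<theta>\<close> \<delta> by (intro lex_nonneg_scale) auto
    ultimately have "lex_nonneg c ((w - z - \<theta> *\<^sub>R \<delta>) + (\<theta> - 1) *\<^sub>R \<delta>)"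
      using lex_nonneg_add by metis
    moreover have "(w - z - \<theta> *\<^sub>R \<delta>) + (\<theta> - 1) *\<^sub>R \<delta> = w - u"
      by (simp add: \<delta>_def algebra_simps)
    ultimately show ?thesis by simp
  qed
  then have "lex_optimal c (\<Inter>B \<inter> H) u" using mem[OF l0(1)] l0(2) by (simp add: lex_optimal_iff_le)
  then show ?thesis ..
qed


section \<open>Mixed integer Gomory cuts\<close>

text \<open>
  The coefficient of the \<open>l\<close>-th slack in the cut, so that the cut is a single sum over all slacks;
  all coefficients are nonnegative.
\<close>

definition MIG_coeff :: "real ^ 'n ^ 'n \<Rightarrow> real ^ 'n \<Rightarrow> 'n \<Rightarrow> 'n \<Rightarrow> real" where
  "MIG_coeff A b k l =
     (let f0 = frac ((matrix_inv A *v b) $ k); abar = matrix_inv A $ k $ l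
      in if abar \<ge> 0 then abar else - (f0 / (1 - f0)) * abar)"

lemma MIG_coeff_nonneg: "0 \<le> MIG_coeff A b k l"
proof -
  have "0 \<le> frac x / (1 - frac x)" for x :: real
    using frac_lt_1[of x] by (intro divide_nonneg_nonneg) auto
  from mult_nonneg_nonpos[OF this] show ?thesis by (auto simp: MIG_coeff_def Let_def)
qed

lemma MIG_cut_alt:
  "MIG_cut A b k =
     {v. frac ((matrix_inv A *v b) $ k) \<le> (\<Sum>l\<in>UNIV. MIG_coeff A b k l * (b - A *v v) $ l)}"
proof -
  define f where "f = frac ((matrix_inv A *v b) $ k)"
  define \<phi> where "\<phi> = f / (1 - f)"
  define R where "R l = matrix_inv A $ k $ l" for l
  have "(\<Sum>l | R l \<ge> 0. R l * s l) - \<phi> * (\<Sum>l | R l < 0. R l * s l)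
      = (\<Sum>l\<in>UNIV. MIG_coeff A b k l * s l)" for s
  proof -
    have "(\<Sum>l\<in>UNIV. MIG_coeff A b k l * s l)
        = (\<Sum>l\<in>{l. R l \<ge> 0} \<union> {l. R l < 0}. MIG_coeff A b k l * s l)"
      by (rule sum.cong) auto
    also have "\<dots> = (\<Sum>l | R l \<ge> 0. MIG_coeff A b k l * s l) + (\<Sum>l | R l < 0. MIG_coeff A b k l * s l)"
      by (rule sum.union_disjoint) auto
    also have "(\<Sum>l | R l \<ge> 0. MIG_coeff A b k l * s l) = (\<Sum>l | R l \<ge> 0. R l * s l)"
      by (rule sum.cong) (auto simp: MIG_coeff_def R_def)
    also have "(\<Sum>l | R l < 0. MIG_coeff A b k l * s l) = (\<Sum>l | R l < 0. - (\<phi> * (R l * s l)))"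
      by (rule sum.cong) (auto simp: MIG_coeff_def R_def \<phi>_def f_def Let_def)
    finally show ?thesis by (simp add: sum_negf sum_distrib_left)
  qed
  then show ?thesis unfolding MIG_cut_def Let_def R_def \<phi>_def f_def by simp
qed

lemma MIG_cut_halfspace: "MIG_cut A b k \<in> halfspaces"
proof -
  define g where "g = (\<chi> l. MIG_coeff A b k l)"
  have "(\<Sum>l\<in>UNIV. MIG_coeff A b k l * (b - A *v v) $ l) = g \<bullet> b - (g v* A) \<bullet> v" for v
  proof -
    have "(\<Sum>l\<in>UNIV. MIG_coeff A b k l * (b - A *v v) $ l) = g \<bullet> (b - A *v v)"
      by (simp add: g_def inner_vec_def)
    then show ?thesis by (simp add: inner_diff_right dot_lmul_matrix)
  qed
  then have "MIG_cut A b k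
      = halfspace (g v* A) (g \<bullet> b - frac ((matrix_inv A *v b) $ k))"
    unfolding MIG_cut_alt halfspace_def by (auto simp only: mem_Collect_eq)
  then show ?thesis unfolding halfspaces_def by blast
qed

lemma basis_component:
  fixes A :: "((real, 'n::{finite,linorder}) vec, 'n) vec"
  assumes d: "describes A b B" and opt: "lex_optimal c (\<Inter>B) z"
  shows "v $ k = z $ k - (\<Sum>l\<in>UNIV. matrix_inv A $ k $ l * (b - A *v v) $ l)"
proof -
  have "(v - z) $ k = (\<Sum>l\<in>UNIV. - (matrix_inv A $ k $ l * (b - A *v v) $ l))"
    unfolding basis_cone(4)[OF d opt, of v] sum_component
    by (intro sum.cong refl) (simp add: column_def)
  then show ?thesis by (simp add: sum_negf)
qed

lemma basis_apex_component:
  fixes A :: "((real, 'n::{finite,linorder}) vec, 'n) vec"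
  assumes d: "describes A b B" and opt: "lex_optimal c (\<Inter>B) z"
  shows "matrix_inv A *v b = z"
  unfolding basis_cone(2)[OF d opt, symmetric]
  by (simp add: matrix_vector_mul_assoc matrix_inv_inverse(2)[OF basis_cone(1)[OF d opt]])

text \<open>
  Split \<open>z $ k - v $ k\<close> as \<open>p - q\<close> with \<open>p, q \<ge> 0\<close> the contributions of \<open>N\<^sub>+\<close> and \<open>N\<^sub>-\<close>. If
  \<open>v $ k\<close> is an integer, then \<open>p - q\<close> differs from \<open>f\<^sub>0\<close> by an integer, so \<open>p \<ge> f\<^sub>0\<close> or
  \<open>q \<ge> 1 - f\<^sub>0\<close>.
\<close>

lemma MIG_cut_valid:
  fixes A :: "((real, 'n::{finite,linorder}) vec, 'n) vec"
  assumes d: "describes A b B" and opt: "lex_optimal c (\<Inter>B) z"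
    and v: "v \<in> \<Inter>B" "v $ k \<in> \<int>"
  shows "v \<in> MIG_cut A b k"
proof -
  define R where "R l = matrix_inv A $ k $ l" for l
  define s where "s l = (b - A *v v) $ l" for l
  define f where "f = frac (z $ k)"
  have s: "0 \<le> s l" for l using v describes_Inter[OF d, of v] by (simp add: s_def)
  have f: "0 \<le> f" "f < 1" by (auto simp: f_def frac_lt_1)
  define p where "p = (\<Sum>l\<in>UNIV. max (R l) 0 * s l)"
  define q where "q = (\<Sum>l\<in>UNIV. max (- R l) 0 * s l)"
  have pq: "0 \<le> p" "0 \<le> q" unfolding p_def q_def using s by (auto intro!: sum_nonneg)
  have "p - q = (\<Sum>l\<in>UNIV. R l * s l)"
    unfolding p_def q_def sum_subtractf[symmetric]
    by (intro sum.cong refl) (auto simp: max_def)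
  also have "\<dots> = z $ k - v $ k"
    using basis_component[OF d opt, of v k] by (simp add: R_def s_def)
  finally have diff: "p - q = z $ k - v $ k" .
  have "MIG_coeff A b k l * s l = max (R l) 0 * s l + f / (1 - f) * (max (- R l) 0 * s l)" for l
    by (auto simp: MIG_coeff_def R_def f_def basis_apex_component[OF d opt] Let_def max_def)
  then have sum: "(\<Sum>l\<in>UNIV. MIG_coeff A b k l * s l) = p + f / (1 - f) * q"
    by (simp add: p_def q_def sum.distrib sum_distrib_left)
  obtain m where m: "p - q = f + of_int m"
  proof -
    obtain j where "v $ k = of_int j" using v(2) by (auto elim: Ints_cases)
    then have "p - q = f + of_int (\<lfloor>z $ k\<rfloor> - j)" using diff by (simp add: f_def frac_def)
    then show ?thesis using that by blast
  qed
  have "f \<le> p + f / (1 - f) * q"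
  proof (cases "0 \<le> m")
    case True
    then have "f \<le> p" using m pq by simp
    moreover have "0 \<le> f / (1 - f) * q" using f pq by simp
    ultimately show ?thesis by linarith
  next
    case False
    then have "real_of_int m \<le> -1" by linarith
    then have "1 - f \<le> q" using m pq by linarith
    then have "f / (1 - f) * (1 - f) \<le> f / (1 - f) * q" using f by (intro mult_left_mono) auto
    then show ?thesis using f pq by simp
  qed
  then show ?thesis
    using sum by (simp add: MIG_cut_alt basis_apex_component[OF d opt] s_def f_def)
qed

text \<open>
  The directions of the cone that leave the cost and the coordinates before \<open>k\<close> unchanged do not
  decrease coordinate \<open>k\<close>, so along them only the indices in \<open>N\<^sub>-\<close> contribute to the cut, which then
  says that coordinate \<open>k\<close> grows by at least \<open>1 - f\<^sub>0\<close>.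
\<close>

lemma MIG_cut_rounds_up:
  fixes A :: "((real, 'n::{finite,linorder}) vec, 'n) vec"
  assumes d: "describes A b B" and opt: "lex_optimal c (\<Inter>B) z" and zk: "z $ k \<notin> \<int>"
    and v: "v \<in> \<Inter>B" "v \<in> MIG_cut A b k"
    and same: "c \<bullet> v = c \<bullet> z" "\<And>m. m < k \<Longrightarrow> v $ m = z $ m"
  shows "of_int \<lceil>z $ k\<rceil> \<le> v $ k"
proof -
  define R where "R l = matrix_inv A $ k $ l" for l
  define s where "s l = (b - A *v v) $ l" for l
  define f where "f = frac (z $ k)"
  define r where "r l = s l *\<^sub>R (- column l (matrix_inv A))" for l
  have s: "0 \<le> s l" for l using v describes_Inter[OF d, of v] by (simp add: s_def)
  have f: "0 < f" "f < 1" using zk by (auto simp: f_def frac_lt_1 frac_gt_0_iff)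
  have r: "lex_nonneg c (r l)" for l
    unfolding r_def by (rule lex_nonneg_scale[OF basis_cone(3)[OF d opt] s])
  have sum_r: "v - z = sum r UNIV"
    unfolding r_def[abs_def] s_def by (rule basis_cone(4)[OF d opt])
  have Rs: "R l * s l \<le> 0" for l
  proof -
    have split: "r l + sum r (UNIV - {l}) = v - z"
      unfolding sum_r by (simp add: sum.remove[of UNIV l])
    have "c \<bullet> r l = 0 \<and> (\<forall>m<k. r l $ m = 0)"
    proof (rule lex_nonneg_summand_prefix[OF r])
      show "lex_nonneg c (sum r (UNIV - {l}))" by (rule lex_nonneg_sum) (rule r)
      show "c \<bullet> (r l + sum r (UNIV - {l})) = 0" using same(1) by (simp only: split inner_diff_right)
      show "(r l + sum r (UNIV - {l})) $ m = 0" if "m < k" for m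
        using same(2)[OF that] by (simp only: split) simp
    qed
    then have "0 \<le> r l $ k" using lex_nonneg_component[OF r] by blast
    then show ?thesis by (simp add: r_def R_def column_def mult.commute)
  qed
  have "MIG_coeff A b k l * s l = f / (1 - f) * - (R l * s l)" for l
  proof (cases "R l \<ge> 0")
    case True
    then have "R l * s l = 0" using Rs[of l] s[of l] mult_nonneg_nonneg[of "R l" "s l"] by linarith
    then show ?thesis using True by (auto simp: MIG_coeff_def R_def Let_def)
  next
    case False
    then show ?thesis
      by (simp add: MIG_coeff_def R_def Let_def f_def basis_apex_component[OF d opt])
  qed
  then have "(\<Sum>l\<in>UNIV. MIG_coeff A b k l * s l) = f / (1 - f) * - (\<Sum>l\<in>UNIV. R l * s l)"
    by (simp add: sum_distrib_left sum_negf)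
  also have "(\<Sum>l\<in>UNIV. R l * s l) = z $ k - v $ k"
    using basis_component[OF d opt, of v k] by (simp add: R_def s_def)
  finally have "f \<le> f / (1 - f) * (v $ k - z $ k)"
    using v(2) by (simp add: MIG_cut_alt basis_apex_component[OF d opt] s_def f_def)
  then have "f * (1 - f) \<le> f * (v $ k - z $ k)" using f by (simp add: pos_le_divide_eq)
  then have "1 - f \<le> v $ k - z $ k" using f by (simp only: mult_le_cancel_left_pos)
  then have "of_int (\<lfloor>z $ k\<rfloor> + 1) \<le> v $ k" by (simp add: f_def frac_def)
  moreover have "\<lceil>z $ k\<rceil> \<le> \<lfloor>z $ k\<rfloor> + 1" by linarith
  ultimately show ?thesis by linarith
qed

lemma int_coords_downward: "k \<in> int_coords dZ \<Longrightarrow> m < k \<Longrightarrow> m \<in> int_coords dZ"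
proof -
  assume k: "k \<in> int_coords dZ" and m: "m < k"
  then have "card {j. j < m} \<le> card {j. j < k}" by (intro card_mono) auto
  then show ?thesis using k by (simp add: int_coords_def)
qed

lemma UNIV_halfspace: "(UNIV :: (real ^ 'n) set) \<in> halfspaces"
proof -
  have "(UNIV :: (real ^ 'n) set) = halfspace 0 0" by (simp add: halfspace_def)
  then show ?thesis unfolding halfspaces_def by blast
qed

lemma MIG_oracle_halfspace: "MIG_oracle dZ z B \<in> halfspaces"
  by (auto simp: MIG_oracle_def UNIV_halfspace MIG_cut_halfspace Let_def split: prod.split)

lemma MIG_oracle_cut:
  fixes B :: "(real, 'n::{finite,linorder}) vec set set"
  assumes "B \<subseteq> halfspaces" "card B = CARD('n)" "z \<notin> mixed_integer dZ"
  obtains A b where "describes A b B"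
    "MIG_oracle dZ z B = MIG_cut A b (Min {k \<in> int_coords dZ. z $ k \<notin> \<int>})"
proof -
  obtain A b where Ab: "(SOME (A, b). describes A b B) = (A, b)"
    by (cases "SOME (A, b). describes A b B") auto
  have "\<exists>p. case p of (A, b) \<Rightarrow> describes A b B"
    using exists_describes[OF assms(1,2)] by auto
  from someI_ex[OF this] have "describes A b B" using Ab by simp
  then show ?thesis using that assms(3) Ab by (simp add: MIG_oracle_def)
qed

lemma Min_fractional:
  assumes "z \<notin> mixed_integer dZ"
  shows "Min {k \<in> int_coords dZ. z $ k \<notin> \<int>} \<in> int_coords dZ"
    and "z $ Min {k \<in> int_coords dZ. z $ k \<notin> \<int>} \<notin> \<int>"
proof -
  have "Min {k \<in> int_coords dZ. z $ k \<notin> \<int>} \<in> {k \<in> int_coords dZ. z $ k \<notin> \<int>}"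
    using assms by (intro Min_in) (auto simp: mixed_integer_def)
  then show "Min {k \<in> int_coords dZ. z $ k \<notin> \<int>} \<in> int_coords dZ"
    and "z $ Min {k \<in> int_coords dZ. z $ k \<notin> \<int>} \<notin> \<int>" by auto
qed

context
  fixes B :: "(real, 'n::{finite,linorder}) vec set set" and c z :: "(real, 'n) vec"
  assumes B: "B \<subseteq> halfspaces" "card B = CARD('n)" and opt: "lex_optimal c (\<Inter>B) z"
begin

lemma MIG_oracle_valid:
  assumes "p \<in> \<Inter>B" "p \<in> mixed_integer dZ"
  shows "p \<in> MIG_oracle dZ z B"
proof (cases "z \<in> mixed_integer dZ")
  case False
  then obtain A b where "describes A b B"
      "MIG_oracle dZ z B = MIG_cut A b (Min {k \<in> int_coords dZ. z $ k \<notin> \<int>})"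
    using MIG_oracle_cut[OF B] by blast
  then show ?thesis
    using MIG_cut_valid[OF _ opt assms(1)] assms(2) Min_fractional(1)[OF False]
    by (auto simp: mixed_integer_def)
qed (simp add: MIG_oracle_def)

lemma MIG_oracle_lex_optimal:
  assumes "p \<in> \<Inter>B" "p \<in> MIG_oracle dZ z B"
  shows "\<exists>w. lex_optimal c (\<Inter>(B \<union> {MIG_oracle dZ z B})) w"
proof (cases "z \<in> mixed_integer dZ")
  case True
  then show ?thesis using opt by (auto simp: MIG_oracle_def)
next
  case False
  then obtain A b where Ab: "describes A b B"
      "MIG_oracle dZ z B = MIG_cut A b (Min {k \<in> int_coords dZ. z $ k \<notin> \<int>})"
    using MIG_oracle_cut[OF B] by blast
  have "0 < frac (z $ Min {k \<in> int_coords dZ. z $ k \<notin> \<int>})"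
    using Min_fractional(2)[OF False] by (simp add: frac_gt_0_iff)
  then have "\<exists>w. lex_optimal c (\<Inter>B \<inter> MIG_oracle dZ z B) w"
    using cut_cone_lex_optimal[OF Ab(1) opt MIG_coeff_nonneg _ MIG_cut_alt] assms Ab(2)
    by (auto simp: basis_apex_component[OF Ab(1) opt])
  then show ?thesis by (simp add: Int_commute)
qed

lemma MIG_oracle_rounds_up:
  assumes "k \<in> int_coords dZ" "z $ k \<notin> \<int>" "\<And>m. m < k \<Longrightarrow> z $ m \<in> \<int>"
    and "v \<in> \<Inter>B" "v \<in> MIG_oracle dZ z B"
    and "c \<bullet> v = c \<bullet> z" "\<And>m. m < k \<Longrightarrow> v $ m = z $ m"
  shows "of_int \<lceil>z $ k\<rceil> \<le> v $ k"
proof -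
  have "z \<notin> mixed_integer dZ" using assms(1,2) by (auto simp: mixed_integer_def)
  then obtain A b where Ab: "describes A b B"
      "MIG_oracle dZ z B = MIG_cut A b (Min {k \<in> int_coords dZ. z $ k \<notin> \<int>})"
    using MIG_oracle_cut[OF B] by blast
  have "Min {k \<in> int_coords dZ. z $ k \<notin> \<int>} = k"
    using assms(1-3) by (intro Min_eqI) (auto simp: not_less[symmetric])
  then show ?thesis
    using MIG_cut_rounds_up[OF Ab(1) opt] assms Ab(2) by simp
qed

end


section \<open>Sequences that become stationary\<close>

text \<open>
  The floors are eventually constant, and a later fractional value would be followed by one with a
  larger floor.
\<close>

lemma eventually_constant_integer:
  fixes u :: "nat \<Rightarrow> real"
  assumes "\<forall>\<^sub>F t in sequentially. u t \<le> u (Suc t)" "\<forall>\<^sub>F t in sequentially. u t \<le> K"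
    and "\<forall>\<^sub>F t in sequentially. u t \<notin> \<int> \<longrightarrow> of_int \<lceil>u t\<rceil> \<le> u (Suc t)"
  shows "\<exists>v\<in>\<int>. \<forall>\<^sub>F t in sequentially. u t = v"
proof -
  have "\<forall>\<^sub>F t in sequentially. u t \<le> u (Suc t) \<and> u t \<le> K \<and> (u t \<notin> \<int> \<longrightarrow> of_int \<lceil>u t\<rceil> \<le> u (Suc t))"
    using assms by eventually_elim auto
  then obtain N where N: "\<And>t. N \<le> t \<Longrightarrow> u t \<le> u (Suc t)" "\<And>t. N \<le> t \<Longrightarrow> u t \<le> K"
      "\<And>t. N \<le> t \<Longrightarrow> u t \<notin> \<int> \<Longrightarrow> of_int \<lceil>u t\<rceil> \<le> u (Suc t)"
    unfolding eventually_sequentially by blast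
  have mono: "u s \<le> u t" if "N \<le> s" "s \<le> t" for s t
    using that(2,1) by (induction t rule: dec_induct) (auto intro: order_trans N(1))
  define \<rho> where "\<rho> t = nat (\<lfloor>K\<rfloor> - \<lfloor>u t\<rfloor>)" for t
  obtain T where T: "N \<le> T" "\<And>t. N \<le> t \<Longrightarrow> \<rho> T \<le> \<rho> t"
    using ex_has_least_nat[of "\<lambda>t. N \<le> t" N \<rho>] by auto
  have floor: "\<lfloor>u t\<rfloor> = \<lfloor>u T\<rfloor>" if "T \<le> t" for t
  proof -
    have "\<lfloor>u T\<rfloor> \<le> \<lfloor>u t\<rfloor>" using mono[OF T(1) that] by (rule floor_mono)
    moreover have "\<lfloor>u t\<rfloor> \<le> \<lfloor>K\<rfloor>" using N(2)[of t] T(1) that by (intro floor_mono) auto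
    moreover have "\<rho> T \<le> \<rho> t" using T that by auto
    ultimately show ?thesis by (simp add: \<rho>_def)
  qed
  have "u t = of_int \<lfloor>u T\<rfloor>" if t: "T \<le> t" for t
  proof -
    have "u t \<in> \<int>"
    proof (rule ccontr)
      assume nint: "u t \<notin> \<int>"
      then have "\<lceil>u t\<rceil> \<le> \<lfloor>u (Suc t)\<rfloor>" using N(3)[of t] t T(1) by (simp add: le_floor_iff)
      also have "\<dots> = \<lfloor>u t\<rfloor>" using floor[of t] floor[of "Suc t"] t by simp
      finally have "of_int \<lfloor>u t\<rfloor> = u t" by linarith
      then show False using nint by (metis Ints_of_int)
    qed
    then show ?thesis using floor[OF t] by (metis Ints_cases floor_of_int)
  qed
  then have "\<forall>\<^sub>F t in sequentially. u t = of_int \<lfloor>u T\<rfloor>"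
    unfolding eventually_sequentially by blast
  then show ?thesis using Ints_of_int by (rule bexI)
qed

lemma eventually_constant_finite_range:
  fixes u :: "nat \<Rightarrow> (real, 'n::{finite,linorder}) vec"
  assumes fin: "finite X" and X: "\<And>t. N \<le> t \<Longrightarrow> u t \<in> X"
    and inc: "\<And>t. N \<le> t \<Longrightarrow> lex_nonneg c (u (Suc t) - u t)"
  shows "\<exists>v. \<forall>\<^sub>F t in sequentially. u t = v"
proof -
  have mono: "lex_nonneg c (u t - u s)" if "N \<le> s" "s \<le> t" for s t
    using that(2,1) by (induction t rule: dec_induct) (auto intro: lex_nonneg_trans[OF _ inc])
  let ?U = "(\<lambda>t. - u t) ` {N..}"
  have "?U \<subseteq> uminus ` X" using X by auto
  then have "finite ?U" using fin finite_subset by blast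
  then obtain y where y: "lex_optimal c ?U y" using finite_lex_optimal[of ?U c] by auto
  then obtain T where T: "N \<le> T" "y = - u T" by (auto simp: lex_optimal_iff_le)
  have "u t = u T" if "T \<le> t" for t
  proof -
    have "lex_nonneg c (- u t - y)" using y that T(1) by (auto simp: lex_optimal_iff_le)
    then have "lex_nonneg c (- (u t - u T))" by (simp add: T(2))
    then have "u t - u T = 0" using lex_nonneg_antisym mono[OF T(1) that] by blast
    then show ?thesis by simp
  qed
  then show ?thesis unfolding eventually_sequentially by blast
qed


section \<open>Runs of the algorithm\<close>

lemma lex_lp_solver_facts:
  fixes c :: "(real, 'n::{finite,linorder}) vec"
  assumes "lex_lp_solver solve" "finite Q" "Q \<subseteq> halfspaces" "\<exists>z. lex_optimal c (\<Inter>Q) z"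
  shows "lex_optimal c (\<Inter>Q) (fst (solve Q c))"
    "snd (solve Q c) \<subseteq> Q" "card (snd (solve Q c)) = CARD('n)"
    "lex_optimal c (\<Inter>(snd (solve Q c))) (fst (solve Q c))"
proof -
  have o: "lex_optimal c (\<Inter>Q) (fst (solve Q c))" and B: "basis c Q (snd (solve Q c))"
    using assms unfolding lex_lp_solver_def by auto
  show "lex_optimal c (\<Inter>Q) (fst (solve Q c))" by (rule o)
  show "snd (solve Q c) \<subseteq> Q" using B by (simp add: basis_def)
  show "card (snd (solve Q c)) = CARD('n)" by (rule card_basis[OF assms(2,3) B])
  show "lex_optimal c (\<Inter>(snd (solve Q c))) (fst (solve Q c))"
    using B lex_optimal_unique[OF o] unfolding basis_def same_lex_optimum_def by metis
qed

lemma cost_cut_halfspace: "cost_cut c z \<in> halfspaces"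
proof -
  have "cost_cut c z = halfspace (- c) (- of_int \<lceil>c \<bullet> z\<rceil>)"
    by (auto simp: cost_cut_def halfspace_def)
  then show ?thesis unfolding halfspaces_def by blast
qed

lemma box_family_halfspaces: "box_family M \<subseteq> (halfspaces :: (real ^ 'n) set set)"
proof -
  have "{z :: real ^ 'n. z $ k \<le> M} = halfspace (axis k 1) M"
    and "{z :: real ^ 'n. z $ k \<ge> - M} = halfspace (- axis k 1) M" for k
    by (auto simp: halfspace_def inner_axis')
  then show ?thesis unfolding box_family_def halfspaces_def by blast
qed

lemma box_family_bound: "z \<in> \<Inter>(box_family M) \<Longrightarrow> z $ k \<le> M"
  by (auto simp: box_family_def)

lemma bounded_box_family: "bounded (\<Inter>(box_family M) :: (real ^ 'n) set)"
proof (rule bounded_subset[OF bounded_cbox])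
  show "\<Inter>(box_family M) \<subseteq> cbox (\<chi> k. - M) (\<chi> k. M)"
    by (auto simp: box_family_def mem_box_cart)
qed

lemma finite_box_family: "finite (box_family M :: (real ^ 'n) set set)"
  by (simp add: box_family_def)

text \<open>
  A run of the algorithm on a finite set \<open>V\<close> of agents with constraint families \<open>h i\<close> that include
  the box, all satisfied by a mixed integer point \<open>zstar\<close> of integer cost.
\<close>

locale dimilp_run =
  fixes LPlexsolv Pivot :: "'n::{finite,linorder} lp_solver" and dZ :: nat
    and c :: "(real, 'n) vec" and h :: "nat \<Rightarrow> (real, 'n) vec set set"
    and E :: "nat \<Rightarrow> (nat \<times> nat) set" and V :: "nat set" and M :: real
    and zstar :: "(real, 'n) vec"
  assumes solvers: "lex_lp_solver LPlexsolv" "lex_lp_solver Pivot"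
    and finite_V: "finite V" and graph: "\<And>t. E t \<subseteq> V \<times> V"
    and h: "\<And>i. i \<in> V \<Longrightarrow> finite (h i)" "\<And>i. i \<in> V \<Longrightarrow> h i \<subseteq> halfspaces"
      "\<And>i. i \<in> V \<Longrightarrow> box_family M \<subseteq> h i"
    and zstar_h: "\<And>i. i \<in> V \<Longrightarrow> zstar \<in> \<Inter>(h i)"
    and zstar_mixed: "zstar \<in> mixed_integer dZ" and zstar_cost: "c \<bullet> zstar \<in> \<int>"
begin

text \<open>
  The state is \<open>(z t i, B t i)\<close>; \<open>H t i\<close> is the family of half-spaces of the linear program solved at
  time \<open>t\<close>, with solution \<open>w t i\<close> and basis \<open>D t i\<close>, and \<open>cut t i\<close> is the resulting Gomory cut.
\<close>

definition z where "z t i = fst (DiMILP LPlexsolv Pivot dZ c h E t i)"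
definition B where "B t i = snd (DiMILP LPlexsolv Pivot dZ c h E t i)"
definition H where
  "H t i = (\<Union>j\<in>in_neighbours E t i. B t j) \<union> B t i \<union> h i \<union> {cost_cut c (z t i)}"
definition w where "w t i = fst (LPlexsolv (H t i) c)"
definition D where "D t i = snd (LPlexsolv (H t i) c)"
definition cut where "cut t i = MIG_oracle dZ (w t i) (D t i)"

lemma step: "DiMILP LPlexsolv Pivot dZ c h E (Suc t) i = Pivot (D t i \<union> {cut t i}) c"
  unfolding DiMILP.simps cut_def w_def D_def H_def z_def B_def Let_def case_prod_unfold by (rule refl)

text \<open>
  The invariant makes every call of the two solvers meet its precondition. The clause about the basis
  is what transfers \<open>z t j\<close> as a lower bound to the agents that receive \<open>B t j\<close>.
\<close>

definition invar where
  "invar t \<longleftrightarrow> (\<forall>i\<in>V. finite (B t i) \<and> B t i \<subseteq> halfspaces \<and>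
     lex_optimal c (\<Inter>(B t i)) (z t i) \<and> zstar \<in> \<Inter>(B t i))"

lemma bounded_lex_optimal:
  assumes "i \<in> V" "h i \<subseteq> Q" "finite Q" "Q \<subseteq> halfspaces" "zstar \<in> \<Inter>Q"
  shows "\<exists>z. lex_optimal c (\<Inter>Q) z"
proof (rule polytope_lex_optimal[OF assms(3,4)])
  show "bounded (\<Inter>Q)"
    using assms(2) h(3)[OF assms(1)] by (intro bounded_subset[OF bounded_box_family[of M]]) auto
  show "\<Inter>Q \<noteq> {}" using assms(5) by blast
qed

lemma invar_LP:
  assumes I: "invar t" and i: "i \<in> V"
  shows "H t i \<subseteq> halfspaces" "zstar \<in> \<Inter>(H t i)" "lex_optimal c (\<Inter>(H t i)) (w t i)"
    "D t i \<subseteq> H t i" "finite (D t i)" "card (D t i) = CARD('n)" "lex_optimal c (\<Inter>(D t i)) (w t i)"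
proof -
  have nb: "in_neighbours E t i \<subseteq> V" using graph[of t] by (auto simp: in_neighbours_def)
  have fin: "finite (H t i)"
    using I i nb h(1)[OF i] finite_subset[OF nb finite_V] by (auto simp: H_def invar_def)
  show hs: "H t i \<subseteq> halfspaces"
    using I i nb h(2)[OF i] cost_cut_halfspace[of c "z t i"] unfolding H_def invar_def by blast
  have "c \<bullet> z t i \<le> c \<bullet> zstar"
    using I i lex_nonneg_inner[of c "zstar - z t i"]
    by (auto simp: invar_def lex_optimal_iff_le inner_diff_right)
  then have "zstar \<in> cost_cut c (z t i)"
    using zstar_cost by (auto simp: cost_cut_def Ints_def ceiling_le_iff)
  then show zs: "zstar \<in> \<Inter>(H t i)"
    using I i nb zstar_h[OF i] unfolding H_def invar_def by blast
  have "\<exists>z. lex_optimal c (\<Inter>(H t i)) z"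
    by (rule bounded_lex_optimal[OF i _ fin hs zs]) (auto simp: H_def)
  from lex_lp_solver_facts[OF solvers(1) fin hs this]
  show "lex_optimal c (\<Inter>(H t i)) (w t i)" "D t i \<subseteq> H t i" "card (D t i) = CARD('n)"
    "lex_optimal c (\<Inter>(D t i)) (w t i)" by (auto simp: w_def D_def)
  then show "finite (D t i)" using fin finite_subset by blast
qed

lemma invar_Pivot:
  assumes I: "invar t" and i: "i \<in> V"
  shows "lex_optimal c (\<Inter>(D t i \<union> {cut t i})) (z (Suc t) i)" "B (Suc t) i \<subseteq> D t i \<union> {cut t i}"
    "lex_optimal c (\<Inter>(B (Suc t) i)) (z (Suc t) i)" "zstar \<in> cut t i"
proof -
  note LP = invar_LP[OF I i]
  have D: "D t i \<subseteq> halfspaces" using LP by blast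
  have zD: "zstar \<in> \<Inter>(D t i)" using LP by blast
  show zcut: "zstar \<in> cut t i"
    unfolding cut_def by (rule MIG_oracle_valid[OF D LP(6,7) zD zstar_mixed])
  have ex: "\<exists>z. lex_optimal c (\<Inter>(D t i \<union> {cut t i})) z"
    using MIG_oracle_lex_optimal[OF D LP(6,7) zD] zcut unfolding cut_def by blast
  have hs: "D t i \<union> {cut t i} \<subseteq> halfspaces"
    using D MIG_oracle_halfspace by (auto simp: cut_def)
  have fin: "finite (D t i \<union> {cut t i})" using LP by simp
  have "lex_optimal c (\<Inter>(D t i \<union> {cut t i})) (fst (Pivot (D t i \<union> {cut t i}) c))"
    "snd (Pivot (D t i \<union> {cut t i}) c) \<subseteq> D t i \<union> {cut t i}"
    "lex_optimal c (\<Inter>(snd (Pivot (D t i \<union> {cut t i}) c))) (fst (Pivot (D t i \<union> {cut t i}) c))"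
    by (rule lex_lp_solver_facts[OF solvers(2) fin hs ex])+
  then show "lex_optimal c (\<Inter>(D t i \<union> {cut t i})) (z (Suc t) i)"
    "B (Suc t) i \<subseteq> D t i \<union> {cut t i}" "lex_optimal c (\<Inter>(B (Suc t) i)) (z (Suc t) i)"
    by (simp_all only: z_def B_def step)
qed

lemma invar: "invar t"
proof (induction t)
  case 0
  show ?case unfolding invar_def
  proof
    fix i assume i: "i \<in> V"
    have "\<exists>z. lex_optimal c (\<Inter>(h i)) z"
      by (rule bounded_lex_optimal[OF i order_refl h(1)[OF i] h(2)[OF i] zstar_h[OF i]])
    from lex_lp_solver_facts[OF solvers(1) h(1)[OF i] h(2)[OF i] this]
    have "B 0 i \<subseteq> h i" "lex_optimal c (\<Inter>(B 0 i)) (z 0 i)"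
      by (simp_all add: B_def z_def)
    then show "finite (B 0 i) \<and> B 0 i \<subseteq> halfspaces \<and>
        lex_optimal c (\<Inter>(B 0 i)) (z 0 i) \<and> zstar \<in> \<Inter>(B 0 i)"
      using h(1,2)[OF i] zstar_h[OF i] finite_subset by blast
  qed
next
  case (Suc t)
  show ?case unfolding invar_def
  proof
    fix i assume i: "i \<in> V"
    note LP = invar_LP[OF Suc i] and Pv = invar_Pivot[OF Suc i]
    have "finite (B (Suc t) i)" using Pv(2) LP(5) finite_subset by blast
    moreover have "B (Suc t) i \<subseteq> halfspaces"
      using Pv(2) LP(1,4) MIG_oracle_halfspace unfolding cut_def by blast
    moreover have "zstar \<in> \<Inter>(B (Suc t) i)" using Pv(2,4) LP(2,4) by blast
    ultimately show "finite (B (Suc t) i) \<and> B (Suc t) i \<subseteq> halfspaces \<and>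
        lex_optimal c (\<Inter>(B (Suc t) i)) (z (Suc t) i) \<and> zstar \<in> \<Inter>(B (Suc t) i)"
      using Pv(3) by blast
  qed
qed

lemmas LP = invar_LP[OF invar] and Piv = invar_Pivot[OF invar]

lemma w_le_z: "i \<in> V \<Longrightarrow> lex_nonneg c (z (Suc t) i - w t i)"
  by (rule lex_optimal_mono[OF LP(7) Piv(1)]) auto

lemma z_le_w: "i \<in> V \<Longrightarrow> j = i \<or> (j, i) \<in> E t \<Longrightarrow> lex_nonneg c (w t i - z t j)"
proof -
  assume i: "i \<in> V" and j: "j = i \<or> (j, i) \<in> E t"
  then have "j \<in> V" using graph[of t] by auto
  then have "lex_optimal c (\<Inter>(B t j)) (z t j)" using invar[of t] by (simp add: invar_def)
  moreover have "B t j \<subseteq> H t i" using j by (auto simp: H_def in_neighbours_def)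
  ultimately show ?thesis using lex_optimal_mono[OF _ LP(3)[OF i]] by blast
qed

lemma w_mono: "i \<in> V \<Longrightarrow> lex_nonneg c (w (Suc t) i - w t i)"
  using lex_nonneg_trans[OF w_le_z z_le_w] by blast

lemma w_le_zstar: "i \<in> V \<Longrightarrow> lex_nonneg c (zstar - w t i)"
  using LP(2,3) by (auto simp: lex_optimal_iff_le)

lemma w_h: "i \<in> V \<Longrightarrow> w t i \<in> \<Inter>(h i)"
  using LP(3) by (auto simp: lex_optimal_iff_le H_def)

lemma cost_stationary:
  assumes i: "i \<in> V"
  shows "\<exists>v\<in>\<int>. \<forall>\<^sub>F t in sequentially. c \<bullet> w t i = v"
proof (rule eventually_constant_integer)
  show "\<forall>\<^sub>F t in sequentially. c \<bullet> w t i \<le> c \<bullet> w (Suc t) i"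
    using lex_nonneg_inner[OF w_mono[OF i]] by (simp add: inner_diff_right)
  show "\<forall>\<^sub>F t in sequentially. c \<bullet> w t i \<le> c \<bullet> zstar"
    using lex_nonneg_inner[OF w_le_zstar[OF i]] by (simp add: inner_diff_right)
  have "of_int \<lceil>c \<bullet> w t i\<rceil> \<le> c \<bullet> w (Suc t) i" for t
  proof -
    have "\<lceil>c \<bullet> w t i\<rceil> \<le> \<lceil>c \<bullet> z (Suc t) i\<rceil>"
      using lex_nonneg_inner[OF w_le_z[OF i]] by (intro ceiling_mono) (simp add: inner_diff_right)
    moreover have "w (Suc t) i \<in> cost_cut c (z (Suc t) i)"
      using LP(3)[OF i, of "Suc t"] by (simp add: lex_optimal_iff_le H_def)
    ultimately show ?thesis by (auto simp: cost_cut_def intro: order_trans[rotated])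
  qed
  then show "\<forall>\<^sub>F t in sequentially. c \<bullet> w t i \<notin> \<int> \<longrightarrow> of_int \<lceil>c \<bullet> w t i\<rceil> \<le> c \<bullet> w (Suc t) i"
    by simp
qed

lemma int_coord_stationary:
  assumes i: "i \<in> V"
  shows "k \<in> int_coords dZ \<Longrightarrow> \<exists>v\<in>\<int>. \<forall>\<^sub>F t in sequentially. w t i $ k = v"
proof (induction "card {j. j < k}" arbitrary: k rule: less_induct)
  case less
  obtain J where J: "\<forall>\<^sub>F t in sequentially. c \<bullet> w t i = J" using cost_stationary[OF i] by blast
  have "\<exists>v\<in>\<int>. \<forall>\<^sub>F t in sequentially. w t i $ m = v" if "m < k" for m
  proof -
    have "{j. j < m} \<subset> {j. j < k}" using that by auto
    then have "card {j. j < m} < card {j. j < k}" by (intro psubset_card_mono) auto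
    then show ?thesis using less.hyps int_coords_downward[OF less.prems that] by blast
  qed
  then obtain x where x: "\<And>m. m < k \<Longrightarrow> x m \<in> \<int>"
      "\<And>m. m < k \<Longrightarrow> \<forall>\<^sub>F t in sequentially. w t i $ m = x m" by metis
  have "\<forall>\<^sub>F t in sequentially. \<forall>m\<in>{m. m < k}. w t i $ m = x m"
    using x(2) by (intro eventually_ball_finite) auto
  with J have now: "\<forall>\<^sub>F t in sequentially. c \<bullet> w t i = J \<and> (\<forall>m<k. w t i $ m = x m)"
    by eventually_elim auto
  have "\<forall>\<^sub>F t in sequentially. c \<bullet> w (Suc t) i = J \<and> (\<forall>m<k. w (Suc t) i $ m = x m)"
    by (rule eventually_sequentially_Suc[THEN iffD2, OF now])
  with now have ev: "\<forall>\<^sub>F t in sequentially. (c \<bullet> w t i = J \<and> (\<forall>m<k. w t i $ m = x m)) \<and>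
      (c \<bullet> w (Suc t) i = J \<and> (\<forall>m<k. w (Suc t) i $ m = x m))"
    by (rule eventually_conj)
  have step: "w t i $ k \<le> w (Suc t) i $ k \<and> (w t i $ k \<notin> \<int> \<longrightarrow> of_int \<lceil>w t i $ k\<rceil> \<le> w (Suc t) i $ k)"
    if t: "(c \<bullet> w t i = J \<and> (\<forall>m<k. w t i $ m = x m)) \<and>
      (c \<bullet> w (Suc t) i = J \<and> (\<forall>m<k. w (Suc t) i $ m = x m))" for t
  proof -
    let ?p = "z (Suc t) i - w t i" and ?q = "w (Suc t) i - z (Suc t) i"
    have p: "lex_nonneg c ?p" and q: "lex_nonneg c ?q" using w_le_z[OF i] z_le_w[OF i] by auto
    have pre: "c \<bullet> ?p = 0 \<and> (\<forall>m<k. ?p $ m = 0)"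
      by (rule lex_nonneg_summand_prefix[OF p q]) (use t in \<open>auto simp: inner_diff_right\<close>)
    have "c \<bullet> ?q = 0 \<and> (\<forall>m<k. ?q $ m = 0)"
      by (rule lex_nonneg_summand_prefix[OF q p]) (use t in \<open>auto simp: inner_diff_right\<close>)
    then have "0 \<le> ?p $ k" "0 \<le> ?q $ k"
      using pre lex_nonneg_component[OF p] lex_nonneg_component[OF q] by blast+
    then have le: "w t i $ k \<le> z (Suc t) i $ k" "z (Suc t) i $ k \<le> w (Suc t) i $ k" by auto
    have "of_int \<lceil>w t i $ k\<rceil> \<le> z (Suc t) i $ k" if "w t i $ k \<notin> \<int>"
    proof (rule MIG_oracle_rounds_up[OF _ LP(6)[OF i] LP(7)[OF i] less.prems that])
      show "D t i \<subseteq> halfspaces" using LP[OF i] by blast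
      show "w t i $ m \<in> \<int>" if "m < k" for m using t x(1) that by simp
      show "z (Suc t) i \<in> \<Inter>(D t i)" "z (Suc t) i \<in> MIG_oracle dZ (w t i) (D t i)"
        using Piv(1)[OF i, of t] by (auto simp: lex_optimal_iff_le cut_def)
      show "c \<bullet> z (Suc t) i = c \<bullet> w t i" using pre by (simp add: inner_diff_right)
      show "z (Suc t) i $ m = w t i $ m" if "m < k" for m using pre that by simp
    qed
    then show ?thesis using le by (meson order_trans)
  qed
  show ?case
  proof (rule eventually_constant_integer)
    show "\<forall>\<^sub>F t in sequentially. w t i $ k \<le> w (Suc t) i $ k"
      using ev by (rule eventually_mono) (use step in blast)
    show "\<forall>\<^sub>F t in sequentially. w t i $ k \<notin> \<int> \<longrightarrow> of_int \<lceil>w t i $ k\<rceil> \<le> w (Suc t) i $ k"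
      using ev by (rule eventually_mono) (use step in blast)
    show "\<forall>\<^sub>F t in sequentially. w t i $ k \<le> M"
      using w_h[OF i] h(3)[OF i] box_family_bound[of _ M k] by (intro always_eventually allI) blast
  qed
qed

lemma eventually_mixed_integer: "i \<in> V \<Longrightarrow> \<forall>\<^sub>F t in sequentially. w t i \<in> mixed_integer dZ"
proof -
  assume i: "i \<in> V"
  have "\<forall>\<^sub>F t in sequentially. \<forall>k\<in>int_coords dZ. w t i $ k \<in> \<int>"
  proof (intro eventually_ball_finite ballI)
    fix k :: 'n assume "k \<in> int_coords dZ"
    then obtain v where "v \<in> \<int>" "\<forall>\<^sub>F t in sequentially. w t i $ k = v"
      using int_coord_stationary[OF i] by blast
    then show "\<forall>\<^sub>F t in sequentially. w t i $ k \<in> \<int>" by (auto elim: eventually_mono)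
  qed simp
  then show ?thesis by (simp add: mixed_integer_def)
qed

lemma no_cut:
  assumes i: "i \<in> V" and "w t i \<in> mixed_integer dZ"
  shows "cut t i = UNIV" "z (Suc t) i = w t i"
proof -
  show "cut t i = UNIV" using assms(2) by (simp add: cut_def MIG_oracle_def)
  then show "z (Suc t) i = w t i"
    using Piv(1)[OF i, of t] lex_optimal_unique LP(7)[OF i, of t] by simp blast
qed

lemma z_mono: "i \<in> V \<Longrightarrow> lex_nonneg c (z (Suc t) i - z t i)"
  using lex_nonneg_trans[OF z_le_w w_le_z] by blast

lemma eventually_stationary:
  shows "\<exists>T v. \<forall>t\<ge>T. \<forall>i\<in>V. z t i = v i \<and> w t i = v i \<and> v i \<in> mixed_integer dZ"
proof -
  obtain J where J: "\<And>i. i \<in> V \<Longrightarrow> J i \<in> \<int>"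
      "\<And>i. i \<in> V \<Longrightarrow> \<forall>\<^sub>F t in sequentially. c \<bullet> w t i = J i"
    using cost_stationary by metis
  have "\<forall>\<^sub>F t in sequentially. \<forall>i\<in>V. c \<bullet> w t i = J i \<and> w t i \<in> mixed_integer dZ"
    using J(2) eventually_mixed_integer
    by (intro eventually_ball_finite finite_V ballI eventually_conj) auto
  then obtain T where T: "\<And>t i. T \<le> t \<Longrightarrow> i \<in> V \<Longrightarrow> c \<bullet> w t i = J i"
      "\<And>t i. T \<le> t \<Longrightarrow> i \<in> V \<Longrightarrow> w t i \<in> mixed_integer dZ"
    unfolding eventually_sequentially by blast
  have zw: "z (Suc t) i = w t i" and cut: "cut t i = UNIV" if "T \<le> t" "i \<in> V" for t i
    using no_cut[OF that(2) T(2)[OF that]] by auto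
  \<comment> \<open>The cost cut only stops changing once it is computed from \<open>z (Suc T)\<close>, hence the start at
    \<open>Suc T\<close>; \<open>UNIV\<close> is the half-space returned when no cut is needed.\<close>
  define F where "F = insert UNIV (\<Union>i\<in>V. B (Suc T) i \<union> h i \<union> {{p. J i \<le> c \<bullet> p}})"
  have "finite F" using finite_V h(1) invar[of "Suc T"] by (auto simp: F_def invar_def)
  have pool: "\<forall>i\<in>V. B t i \<subseteq> F" if "Suc T \<le> t" for t
    using that
  proof (induction t rule: dec_induct)
    case base
    then show ?case by (auto simp: F_def)
  next
    case (step t)
    show ?case
    proof
      fix i assume i: "i \<in> V"
      obtain t' where t': "t = Suc t'" "T \<le> t'" using step by (cases t) auto
      have "c \<bullet> z t i = J i" using zw[OF t'(2) i] T(1)[OF t'(2) i] t'(1) by simp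
      then have "cost_cut c (z t i) = {p. J i \<le> c \<bullet> p}"
        using J(1)[OF i] by (auto simp: cost_cut_def Ints_def)
      moreover have "in_neighbours E t i \<subseteq> V" using graph[of t] by (auto simp: in_neighbours_def)
      ultimately have "H t i \<subseteq> F" using step.IH i unfolding H_def F_def by blast
      then show "B (Suc t) i \<subseteq> F"
        using LP(4)[OF i, of t] Piv(2)[OF i, of t] cut[of t i] i step(1) by (auto simp: F_def)
    qed
  qed
  have "\<exists>v. \<forall>\<^sub>F t in sequentially. z t i = v" if i: "i \<in> V" for i
  proof (rule eventually_constant_finite_range)
    let ?X = "(\<lambda>Q. THE p. lex_optimal c (\<Inter>Q) p) ` Pow F"
    show "finite ?X" using \<open>finite F\<close> by simp
    show "z t i \<in> ?X" if "Suc T \<le> t" for t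
    proof
      have "lex_optimal c (\<Inter>(B t i)) (z t i)" using invar[of t] i by (simp add: invar_def)
      then show "z t i = (THE p. lex_optimal c (\<Inter>(B t i)) p)"
        using lex_optimal_unique by (intro the_equality[symmetric]) blast+
      show "B t i \<in> Pow F" using pool[OF that] i by blast
    qed
    show "lex_nonneg c (z (Suc t) i - z t i)" for t by (rule z_mono[OF i])
  qed
  then obtain v where "\<And>i. i \<in> V \<Longrightarrow> \<forall>\<^sub>F t in sequentially. z t i = v i" by metis
  then have "\<forall>\<^sub>F t in sequentially. \<forall>i\<in>V. z t i = v i"
    by (intro eventually_ball_finite finite_V) auto
  then obtain T' where T': "\<And>t i. T' \<le> t \<Longrightarrow> i \<in> V \<Longrightarrow> z t i = v i"
    unfolding eventually_sequentially by blast
  have "z t i = v i \<and> w t i = v i \<and> v i \<in> mixed_integer dZ" if "max T T' \<le> t" "i \<in> V" for t i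
    using T'[of t i] T'[of "Suc t" i] zw[of t i] T(2)[of t i] that by auto
  then show ?thesis by blast
qed

text \<open>
  Information only ever raises an agent's point, so along the edges the limits increase, and strong
  connectivity makes them all equal.
\<close>

lemma consensus:
  assumes "jointly_strongly_connected V E"
  shows "\<exists>T p. (\<forall>t\<ge>T. \<forall>i\<in>V. z t i = p) \<and>
    (\<forall>i\<in>V. p \<in> \<Inter>(h i) \<and> p \<in> mixed_integer dZ \<and> lex_nonneg c (zstar - p))"
proof -
  obtain T v where Tv: "\<And>t i. T \<le> t \<Longrightarrow> i \<in> V \<Longrightarrow> z t i = v i \<and> w t i = v i \<and> v i \<in> mixed_integer dZ"
    using eventually_stationary by blast
  have path: "i \<in> V \<longrightarrow> lex_nonneg c (v j - v i)" if "(i, j) \<in> (\<Union>\<tau>\<in>{T..}. E \<tau>)\<^sup>*" for i j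
    using that
  proof (induction rule: rtrancl_induct)
    case (step j k)
    then obtain t where t: "T \<le> t" "(j, k) \<in> E t" by auto
    then have "j \<in> V" "k \<in> V" using graph[of t] by auto
    then have "lex_nonneg c (v k - v j)" using z_le_w[of k j t] Tv[of t] t by simp
    then show ?case using step.IH lex_nonneg_trans by blast
  qed simp
  have eq: "v i = v j" if "i \<in> V" "j \<in> V" for i j
  proof -
    have "lex_nonneg c (v j - v i)" "lex_nonneg c (v i - v j)"
      using path that assms unfolding jointly_strongly_connected_def by blast+
    then show ?thesis using lex_nonneg_antisym[of c "v i - v j"] by simp
  qed
  show ?thesis
  proof (cases "V = {}")
    case False
    then obtain i0 where i0: "i0 \<in> V" by blast
    have "z t i = v i0" if "T \<le> t" "i \<in> V" for t i using Tv[OF that] eq[OF that(2) i0] by simp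
    moreover have "v i0 \<in> \<Inter>(h i) \<and> v i0 \<in> mixed_integer dZ \<and> lex_nonneg c (zstar - v i0)"
      if "i \<in> V" for i
      using Tv[OF order_refl that] eq[OF that i0] w_h[OF that, of T] w_le_zstar[OF that, of T] by simp
    ultimately show ?thesis by blast
  qed simp
qed

end


section \<open>Finite convergence of DiMILP\<close>

theorem mainTheorem1:
  fixes a :: "nat \<Rightarrow> (real, 'n::{finite,linorder}) vec"
    and b :: "nat \<Rightarrow> real"
    and c zstar :: "(real, 'n) vec"
    and n dZ dR :: nat
    and M :: real
    and E :: "nat \<Rightarrow> (nat \<times> nat) set"
    and LPlexsolv Pivot :: "'n lp_solver"
    and P S :: "(real, 'n) vec set"
    and state :: "nat \<Rightarrow> nat \<Rightarrow> (real, 'n) vec \<times> (real, 'n) vec set set"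
  assumes P_eq: "P = (\<Inter>i\<in>{1..n}. halfspace (a i) (b i))"
    and S_eq: "S = P \<inter> mixed_integer dZ"
    and state_eq: "state = DiMILP LPlexsolv Pivot dZ c (\<lambda>i. local_family (a i) (b i) M) E"
    and dim: "CARD('n) = dZ + dR"
    and solvers: "lex_lp_solver LPlexsolv" "lex_lp_solver Pivot"
    and graph: "\<And>t. E t \<subseteq> {1..n} \<times> {1..n}"
    and connected: "jointly_strongly_connected {1..n} E"
    and bounded: "bounded P"
    and zstar: "lex_optimal c (convex hull S) zstar"
    and integer_cost: "c \<bullet> zstar \<in> \<int>"
    and M_pos: "M > 0"
    and M_large: "\<And>z. lex_optimal c (P \<inter> \<Inter>(box_family M) \<inter> mixed_integer dZ) z
                       \<longleftrightarrow> lex_optimal c S z"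
  shows "\<exists>zopt. lex_optimal c S zopt \<and>
    (\<forall>i\<in>{1..n}. (\<exists>T. \<forall>t\<ge>T. c \<bullet> fst (state t i) = c \<bullet> zstar) \<and>
                (\<exists>T. \<forall>t\<ge>T. fst (state t i) = zopt))"
proof -
  have S: "lex_optimal c S zstar" by (rule lex_optimal_convex_hull[OF zstar])
  then have "zstar \<in> P \<inter> \<Inter>(box_family M) \<inter> mixed_integer dZ"
    using M_large[of zstar] by (simp add: lex_optimal_iff_le)
  then have zs: "zstar \<in> P" "zstar \<in> \<Inter>(box_family M)" "zstar \<in> mixed_integer dZ" by auto
  interpret dimilp_run LPlexsolv Pivot dZ c "\<lambda>i. local_family (a i) (b i) M" E "{1..n}" M zstar
  proof
    fix i assume i: "i \<in> {1..n}"
    show "finite (local_family (a i) (b i) M)" by (simp add: local_family_def finite_box_family)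
    show "local_family (a i) (b i) M \<subseteq> halfspaces"
      using box_family_halfspaces[of M] by (auto simp: local_family_def halfspaces_def)
    show "box_family M \<subseteq> local_family (a i) (b i) M" by (auto simp: local_family_def)
    show "zstar \<in> \<Inter>(local_family (a i) (b i) M)" using zs i by (simp add: local_family_def P_eq)
  qed (use solvers graph zs integer_cost in auto)
  obtain T p where Tp: "\<And>t i. T \<le> t \<Longrightarrow> i \<in> {1..n} \<Longrightarrow> fst (state t i) = p"
      "\<And>i. i \<in> {1..n} \<Longrightarrow> p \<in> \<Inter>(local_family (a i) (b i) M) \<and> p \<in> mixed_integer dZ \<and>
        lex_nonneg c (zstar - p)"
    using consensus[OF connected] unfolding z_def state_eq by blast
  have "p = zstar" if i: "i \<in> {1..n}" for i
  proof -
    have "p \<in> S" using Tp(2) i by (auto simp: S_eq P_eq local_family_def)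
    then have "lex_nonneg c (p - zstar)" using S by (simp add: lex_optimal_iff_le)
    then show ?thesis using Tp(2)[OF i] lex_nonneg_antisym[of c "p - zstar"] by simp
  qed
  then have "fst (state t i) = zstar" if "T \<le> t" "i \<in> {1..n}" for t i
    using Tp(1)[OF that] that(2) by blast
  then have "\<forall>i\<in>{1..n}. (\<exists>T. \<forall>t\<ge>T. c \<bullet> fst (state t i) = c \<bullet> zstar) \<and>
      (\<exists>T. \<forall>t\<ge>T. fst (state t i) = zstar)"
    by (intro ballI conjI exI[of _ T]) simp_all
  then show ?thesis using S by blast
qed

end
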